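(* Let $A$ be a left-handed noncommutative frame such that the frame $A/\mathcal{D}$ is spatial. Then the following are equivalent: (1) for all $a,b\in A$ in the same $\mathcal{D}$-class with $a\neq b$, there is a morphism of noncommutative frames $q:A\to P_{\{1_a,1_b\}}$ such that $q(a)=1_a$ and $q(b)=1_b$; (2) the natural map $\sigma:A\to H(G(A))$, $a\mapsto(U_a,s_a)$, is injective; (3) there is an injective morphism of noncommutative frames $A\to A'$ for some spatial noncommutative frame $A'$; (4) there is an injective morphism of noncommutative frames $A\to\mathcal{P}(R,S)$ for some sets $R$ and $S$.
   Context: **Skew lattices.** A skew lattice is a set $A$ with idempotent associative operations $\wedge,\vee$ satisfying $x\wedge(x\vee y)=x=x\vee(x\wedge y)$ and $(x\wedge y)\vee y=y=(x\vee y)\wedge y$. Natural partial order: $a\le b$ iff $a\wedge b=b\wedge a=a$. Green's relation: $a\,\mathcal{D}\,b$ iff $a\wedge b\wedge a=a$ and $b\wedge a\wedge b=b$; it is a congruence, $A/\mathcal{D}$ is a lattice (the commutative shadow), and $[a]$ denotes the class of $a$. $A$ is left-handed if $x\wedge y\wedge x=x\wedge y$ holds identically; strongly distributive if $(x\vee y)\wedge z=(x\wedge z)\vee(y\wedge z)$ and $x\wedge(y\vee z)=(x\wedge y)\vee(x\wedge z)$ hold identically. A skew lattice with $0$ has a distinguished element $0$ with $x\vee 0=x=0\vee x$ for all $x$. A commuting subset is a nonempty subset $\{x_i\}_{i\in I}$ with $x_i\wedge x_j=x_j\wedge x_i$ and $x_i\vee x_j=x_j\vee x_i$ for all $i,j$.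 $A$ is join complete if all commuting subsets have suprema for the natural partial order. **Noncommutative frames.** A noncommutative frame is a strongly distributive, join complete skew lattice $A$ with $0$ such that $(\bigvee_i x_i)\wedge y=\bigvee_i(x_i\wedge y)$ and $x\wedge(\bigvee_i y_i)=\bigvee_i(x\wedge y_i)$ for all $x,y\in A$ and all commuting subsets $\{x_i\},\{y_i\}$. It has a maximal $\mathcal{D}$-class, and $A/\mathcal{D}$ is a frame. A morphism of noncommutative frames is a map preserving $\wedge$, $\vee$, $0$, and suprema of commuting subsets, and sending elements of the maximal $\mathcal{D}$-class to elements of the maximal $\mathcal{D}$-class. A frame is spatial if it is isomorphic to the frame of opens of a topological space. **Examples of noncommutative frames.** $P_{\{1_a,1_b\}}$ is the left-handed primitive skew lattice $\{0,1_a,1_b\}$ with $0$ as zero element and a single other $\mathcal{D}$-class $\{1_a,1_b\}$ of two distinct elements, where $x\wedge y=x$ and $x\vee y=y$ for $x,y\in\{1_a,1_b\}$. $\mathcal{P}(R,S)$ is the set of partial functions from $R$ to $S$, with $f\wedge g=f|_{\mathrm{dom}(f)\cap\mathrm{dom}(g)}$ and $f\vee g=g\cup f|_{\mathrm{dom}(f)\setminus\mathrm{dom}(g)}$. **The functor $H$ and spatiality.** For a topological space $Y$, $Y_f$ is the set $Y$ with the front topology, with basis the locally closed subsets of $Y$. For $\mathcal{E}$ a sheaf on $Y_f$ with $\mathcal{E}(Y_f)\neq\varnothing$, $H(Y,\mathcal{E})$ is the left-handed noncommutative frame of pairs $(U,s)$ with $U\subseteq Y$ open in the original topology and $s\in\mathcal{E}(U)$,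 with $(U,s)\wedge(V,t)=(U\cap V,s|_{U\cap V})$ and $(U,s)\vee(V,t)=(U\cup V,\,s|_{U-V}\cup t)$, where $s|_{U-V}\cup t$ is the unique section over $U\cup V$ restricting to $s|_{U-V}$ on $U-V$ and to $t$ on $V$. A left-handed noncommutative frame is spatial if it is isomorphic to some such $H(Y,\mathcal{E})$. **The pair $G(A)$.** $G(A)=(Y_A,\mathcal{E}_A)$, where $Y_A$ is the set of frame homomorphisms $p:A/\mathcal{D}\to\mathbf{2}=\{0,1\}$, with open sets $U_a=\{p: p(a)=1\}$, $a\in A$ (where $p(a):=p([a])$). For $p\in Y_A$ and $a,b\in A$ with $p(a)=p(b)=1$, put $a\sim_p b$ iff there are $c,d\in A$ with $p(c)=0$, $p(d)=1$ and $(a\wedge d)\vee c=(b\wedge d)\vee c$; this is an equivalence relation. Let $E_A=\{(p,[a]_{\sim_p}): p\in Y_A, a\in A, p(a)=1\}$, $\pi_A(p,[a]_{\sim_p})=p$, and $s_a:U_a\to E_A$, $s_a(p)=(p,[a]_{\sim_p})$. Give $E_A$ the topology generated by the sets $s_a(Z)$ with $a\in A$ and $Z\subseteq U_a$ locally closed in $Y_A$. Then $\mathcal{E}_A$ is the sheaf on $(Y_A)_f$ of continuous sections of $\pi_A:E_A\to (Y_A)_f$, and $s_a\in\mathcal{E}_A(U_a)$. *)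

theory Defs
  imports "HOL-Algebra.Complete_Lattice" "HOL-Analysis.Abstract_Topology"
begin

section \<open>Skew lattices\<close>

record 'a skew_algebra = "'a partial_object" +
  skew_meet :: "'a \<Rightarrow> 'a \<Rightarrow> 'a"  (infixl \<open>\<^bold>\<and>\<index>\<close> 70)
  skew_join :: "'a \<Rightarrow> 'a \<Rightarrow> 'a"  (infixl \<open>\<^bold>\<or>\<index>\<close> 65)
  skew_zero :: 'a                (\<open>\<^bold>0\<index>\<close>)

locale skew_lattice =
  fixes A :: "'a skew_algebra" (structure)
  assumes meet_closed: "\<lbrakk>x \<in> carrier A; y \<in> carrier A\<rbrakk> \<Longrightarrow> x \<^bold>\<and> y \<in> carrier A"
    and join_closed: "\<lbrakk>x \<in> carrier A; y \<in> carrier A\<rbrakk> \<Longrightarrow> x \<^bold>\<or> y \<in> carrier A"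
    and meet_idem: "x \<in> carrier A \<Longrightarrow> x \<^bold>\<and> x = x"
    and join_idem: "x \<in> carrier A \<Longrightarrow> x \<^bold>\<or> x = x"
    and meet_assoc: "\<lbrakk>x \<in> carrier A; y \<in> carrier A; z \<in> carrier A\<rbrakk>
          \<Longrightarrow> (x \<^bold>\<and> y) \<^bold>\<and> z = x \<^bold>\<and> (y \<^bold>\<and> z)"
    and join_assoc: "\<lbrakk>x \<in> carrier A; y \<in> carrier A; z \<in> carrier A\<rbrakk>
          \<Longrightarrow> (x \<^bold>\<or> y) \<^bold>\<or> z = x \<^bold>\<or> (y \<^bold>\<or> z)"
    and absorb1: "\<lbrakk>x \<in> carrier A; y \<in> carrier A\<rbrakk> \<Longrightarrow> x \<^bold>\<and> (x \<^bold>\<or> y) = x"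
    and absorb2: "\<lbrakk>x \<in> carrier A; y \<in> carrier A\<rbrakk> \<Longrightarrow> x \<^bold>\<or> (x \<^bold>\<and> y) = x"
    and absorb3: "\<lbrakk>x \<in> carrier A; y \<in> carrier A\<rbrakk> \<Longrightarrow> (x \<^bold>\<and> y) \<^bold>\<or> y = y"
    and absorb4: "\<lbrakk>x \<in> carrier A; y \<in> carrier A\<rbrakk> \<Longrightarrow> (x \<^bold>\<or> y) \<^bold>\<and> y = y"

locale skew_lattice_with_zero = skew_lattice +
  assumes zero_closed: "\<^bold>0 \<in> carrier A"
    and zero_right: "x \<in> carrier A \<Longrightarrow> x \<^bold>\<or> \<^bold>0 = x"
    and zero_left: "x \<in> carrier A \<Longrightarrow> \<^bold>0 \<^bold>\<or> x = x"

definition natural_order :: "'a skew_algebra \<Rightarrow> 'a gorder" where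
  "natural_order A =
     \<lparr>carrier = carrier A, eq = (=), le = (\<lambda>a b. a \<^bold>\<and>\<^bsub>A\<^esub> b = a \<and> b \<^bold>\<and>\<^bsub>A\<^esub> a = a)\<rparr>"

definition greenD :: "'a skew_algebra \<Rightarrow> ('a \<times> 'a) set" where
  "greenD A = {(a, b). a \<in> carrier A \<and> b \<in> carrier A \<and>
     a \<^bold>\<and>\<^bsub>A\<^esub> b \<^bold>\<and>\<^bsub>A\<^esub> a = a \<and> b \<^bold>\<and>\<^bsub>A\<^esub> a \<^bold>\<and>\<^bsub>A\<^esub> b = b}"

abbreviation Dclass :: "'a skew_algebra \<Rightarrow> 'a \<Rightarrow> 'a set" where
  "Dclass A a \<equiv> greenD A `` {a}"

definition shadow_meet :: "'a skew_algebra \<Rightarrow> 'a set \<Rightarrow> 'a set \<Rightarrow> 'a set" where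
  "shadow_meet A X Y = (\<Union>x\<in>X. \<Union>y\<in>Y. Dclass A (x \<^bold>\<and>\<^bsub>A\<^esub> y))"

text \<open>The commutative shadow \<open>A/\<D>\<close>, as a lattice ordered by \<open>X \<le> Y \<longleftrightarrow> X \<and> Y = X\<close>.\<close>

definition shadow :: "'a skew_algebra \<Rightarrow> 'a set gorder" where
  "shadow A =
     \<lparr>carrier = carrier A // greenD A, eq = (=), le = (\<lambda>X Y. shadow_meet A X Y = X)\<rparr>"

definition maximal_Dclass :: "'a skew_algebra \<Rightarrow> 'a set" where
  "maximal_Dclass A =
     {a \<in> carrier A. greatest (shadow A) (Dclass A a) (carrier (shadow A))}"

definition left_handed :: "'a skew_algebra \<Rightarrow> bool" where
  "left_handed A \<longleftrightarrow>
     (\<forall>x\<in>carrier A. \<forall>y\<in>carrier A. x \<^bold>\<and>\<^bsub>A\<^esub> y \<^bold>\<and>\<^bsub>A\<^esub> x = x \<^bold>\<and>\<^bsub>A\<^esub> y)"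

definition strongly_distributive :: "'a skew_algebra \<Rightarrow> bool" where
  "strongly_distributive A \<longleftrightarrow>
     (\<forall>x\<in>carrier A. \<forall>y\<in>carrier A. \<forall>z\<in>carrier A.
        (x \<^bold>\<or>\<^bsub>A\<^esub> y) \<^bold>\<and>\<^bsub>A\<^esub> z = (x \<^bold>\<and>\<^bsub>A\<^esub> z) \<^bold>\<or>\<^bsub>A\<^esub> (y \<^bold>\<and>\<^bsub>A\<^esub> z) \<and>
        x \<^bold>\<and>\<^bsub>A\<^esub> (y \<^bold>\<or>\<^bsub>A\<^esub> z) = (x \<^bold>\<and>\<^bsub>A\<^esub> y) \<^bold>\<or>\<^bsub>A\<^esub> (x \<^bold>\<and>\<^bsub>A\<^esub> z))"

definition commuting_subset :: "'a skew_algebra \<Rightarrow> 'a set \<Rightarrow> bool" where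
  "commuting_subset A X \<longleftrightarrow> X \<noteq> {} \<and> X \<subseteq> carrier A \<and>
     (\<forall>x\<in>X. \<forall>y\<in>X. x \<^bold>\<and>\<^bsub>A\<^esub> y = y \<^bold>\<and>\<^bsub>A\<^esub> x \<and> x \<^bold>\<or>\<^bsub>A\<^esub> y = y \<^bold>\<or>\<^bsub>A\<^esub> x)"

definition join_complete :: "'a skew_algebra \<Rightarrow> bool" where
  "join_complete A \<longleftrightarrow>
     (\<forall>X. commuting_subset A X \<longrightarrow> (\<exists>s. is_lub (natural_order A) s X))"


section \<open>Noncommutative frames\<close>

text \<open>Suprema of commuting subsets are written relationally with \<^const>\<open>least\<close>: an equation
  \<open>f (\<Squnion>X) = \<Squnion>(f ` X)\<close> says that \<open>f s\<close> is the supremum of \<open>f ` X\<close> whenever \<open>s\<close> is that of \<open>X\<close>.\<close>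

locale noncommutative_frame = skew_lattice_with_zero +
  assumes strongly_distributive: "strongly_distributive A"
    and join_complete: "join_complete A"
    and Sup_meet: "\<lbrakk>commuting_subset A X; is_lub (natural_order A) s X; y \<in> carrier A\<rbrakk>
          \<Longrightarrow> is_lub (natural_order A) (s \<^bold>\<and> y) ((\<lambda>x. x \<^bold>\<and> y) ` X)"
    and meet_Sup: "\<lbrakk>commuting_subset A Y; is_lub (natural_order A) s Y; x \<in> carrier A\<rbrakk>
          \<Longrightarrow> is_lub (natural_order A) (x \<^bold>\<and> s) ((\<lambda>y. x \<^bold>\<and> y) ` Y)"

definition ncframe_hom :: "'a skew_algebra \<Rightarrow> 'b skew_algebra \<Rightarrow> ('a \<Rightarrow> 'b) \<Rightarrow> bool" where
  "ncframe_hom A B f \<longleftrightarrow>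
     f \<in> carrier A \<rightarrow> carrier B \<and>
     (\<forall>x\<in>carrier A. \<forall>y\<in>carrier A. f (x \<^bold>\<and>\<^bsub>A\<^esub> y) = f x \<^bold>\<and>\<^bsub>B\<^esub> f y) \<and>
     (\<forall>x\<in>carrier A. \<forall>y\<in>carrier A. f (x \<^bold>\<or>\<^bsub>A\<^esub> y) = f x \<^bold>\<or>\<^bsub>B\<^esub> f y) \<and>
     f \<^bold>0\<^bsub>A\<^esub> = \<^bold>0\<^bsub>B\<^esub> \<and>
     (\<forall>X s. commuting_subset A X \<and> is_lub (natural_order A) s X
        \<longrightarrow> is_lub (natural_order B) (f s) (f ` X)) \<and>
     f ` maximal_Dclass A \<subseteq> maximal_Dclass B"

definition ncframe_iso :: "'a skew_algebra \<Rightarrow> 'b skew_algebra \<Rightarrow> bool" where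
  "ncframe_iso A B \<longleftrightarrow> (\<exists>f g. ncframe_hom A B f \<and> ncframe_hom B A g \<and>
     (\<forall>x\<in>carrier A. g (f x) = x) \<and> (\<forall>y\<in>carrier B. f (g y) = y))"

datatype prim = Zero | OneA | OneB

fun prim_meet :: "prim \<Rightarrow> prim \<Rightarrow> prim" where
  "prim_meet x Zero = Zero"
| "prim_meet x y = x"

fun prim_join :: "prim \<Rightarrow> prim \<Rightarrow> prim" where
  "prim_join x Zero = x"
| "prim_join x y = y"

definition primitive_skew :: "prim skew_algebra" where
  "primitive_skew =
     \<lparr>carrier = UNIV, skew_meet = prim_meet, skew_join = prim_join, skew_zero = Zero\<rparr>"

text \<open>\<open>f \<or> g = g \<union> f|(dom f - dom g)\<close> is the override \<open>f ++ g\<close> of maps.\<close>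

definition partial_functions :: "'r set \<Rightarrow> 's set \<Rightarrow> ('r \<rightharpoonup> 's) skew_algebra" where
  "partial_functions R S =
     \<lparr>carrier = {f. dom f \<subseteq> R \<and> ran f \<subseteq> S},
      skew_meet = (\<lambda>f g. f |` (dom f \<inter> dom g)), skew_join = (\<lambda>f g. f ++ g),
      skew_zero = Map.empty\<rparr>"


section \<open>Frames\<close>

locale frame = complete_lattice +
  assumes inf_Sup: "\<lbrakk>x \<in> carrier L; Y \<subseteq> carrier L\<rbrakk>
    \<Longrightarrow> x \<sqinter> \<Squnion>Y = \<Squnion>((\<lambda>y. x \<sqinter> y) ` Y)"

definition frame_hom :: "'a gorder \<Rightarrow> 'b gorder \<Rightarrow> ('a \<Rightarrow> 'b) \<Rightarrow> bool" where
  "frame_hom L M h \<longleftrightarrow>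
     h \<in> carrier L \<rightarrow> carrier M \<and>
     h \<top>\<^bsub>L\<^esub> = \<top>\<^bsub>M\<^esub> \<and>
     (\<forall>x\<in>carrier L. \<forall>y\<in>carrier L. h (x \<sqinter>\<^bsub>L\<^esub> y) = h x \<sqinter>\<^bsub>M\<^esub> h y) \<and>
     (\<forall>X. X \<subseteq> carrier L \<longrightarrow> h (\<Squnion>\<^bsub>L\<^esub>X) = \<Squnion>\<^bsub>M\<^esub>(h ` X))"

definition frame_iso :: "'a gorder \<Rightarrow> 'b gorder \<Rightarrow> bool" where
  "frame_iso L M \<longleftrightarrow> (\<exists>h k. frame_hom L M h \<and> frame_hom M L k \<and>
     (\<forall>x\<in>carrier L. k (h x) = x) \<and> (\<forall>y\<in>carrier M. h (k y) = y))"

definition frame_of_opens :: "'x topology \<Rightarrow> 'x set gorder" where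
  "frame_of_opens X = \<lparr>carrier = {U. openin X U}, eq = (=), le = (\<subseteq>)\<rparr>"

definition two :: "bool gorder" where
  "two = \<lparr>carrier = UNIV, eq = (=), le = (\<le>)\<rparr>"

lemma complete_lattice_two: "complete_lattice two"
  apply unfold_locales
         apply (auto simp: two_def least_def greatest_def Upper_def Lower_def)
  done

lemma sup_two: "\<Squnion>\<^bsub>two\<^esub>X = (\<exists>x\<in>X. x)"
proof -
  interpret complete_lattice two by (rule complete_lattice_two)
  have l: "least two (\<exists>x\<in>X. x) (Upper two X)" by (auto simp: two_def least_def Upper_def)
  show ?thesis unfolding sup_def by (rule some_equality[where P="\<lambda>x. least two x (Upper two X)", OF l]) (rule least_unique[OF _ l])
qed

lemma meet_two: "a \<sqinter>\<^bsub>two\<^esub> b = (a \<and> b)"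
proof -
  interpret complete_lattice two by (rule complete_lattice_two)
  have l: "greatest two (a \<and> b) (Lower two {a,b})" by (auto simp: two_def greatest_def Lower_def)
  show ?thesis unfolding meet_def inf_def by (rule some_equality[where P="\<lambda>x. greatest two x (Lower two {a,b})", OF l]) (rule greatest_unique[OF _ l])
qed

text \<open>The points of the space range over a type, which is passed as an explicit argument.\<close>

definition spatial_frame :: "'x itself \<Rightarrow> 'a gorder \<Rightarrow> bool" where
  "spatial_frame _ L \<longleftrightarrow> frame L \<and> (\<exists>X :: 'x topology. frame_iso L (frame_of_opens X))"


section \<open>Sheaves for the front topology and the functor H\<close>

definition locally_closed_in :: "'y topology \<Rightarrow> 'y set \<Rightarrow> bool" where
  "locally_closed_in Y Z \<longleftrightarrow> (\<exists>U C. openin Y U \<and> closedin Y C \<and> Z = U \<inter> C)"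

definition front :: "'y topology \<Rightarrow> 'y topology" where
  "front Y = topology (arbitrary union_of locally_closed_in Y)"

lemma openin_front:
  "openin (front Y) = arbitrary union_of locally_closed_in Y"
proof -
  have "locally_closed_in Y (S \<inter> T)" if ST: "locally_closed_in Y S" "locally_closed_in Y T" for S T
  proof -
    obtain U C V D where "openin Y U" "closedin Y C" "S = U \<inter> C"
      "openin Y V" "closedin Y D" "T = V \<inter> D"
      using ST unfolding locally_closed_in_def by metis
    then have "openin Y (U \<inter> V) \<and> closedin Y (C \<inter> D) \<and> S \<inter> T = (U \<inter> V) \<inter> (C \<inter> D)"
      by auto
    then show ?thesis unfolding locally_closed_in_def by blast
  qed
  then have "istopology (arbitrary union_of locally_closed_in Y)"
    by (rule istopology_base)
  then show ?thesis by (simp add: front_def topology_inverse')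
qed

record ('y, 's) presheaf =
  sections :: "'y set \<Rightarrow> 's set"
  res :: "'y set \<Rightarrow> 'y set \<Rightarrow> 's \<Rightarrow> 's"  \<comment> \<open>\<open>res E U V\<close> restricts from \<open>U\<close> to \<open>V \<subseteq> U\<close>\<close>

locale sheaf =
  fixes T :: "'y topology" and E :: "('y, 's) presheaf"
  assumes res_closed: "\<lbrakk>openin T U; openin T V; V \<subseteq> U; s \<in> sections E U\<rbrakk>
          \<Longrightarrow> res E U V s \<in> sections E V"
    and res_id: "\<lbrakk>openin T U; s \<in> sections E U\<rbrakk> \<Longrightarrow> res E U U s = s"
    and res_comp: "\<lbrakk>openin T U; openin T V; openin T W; W \<subseteq> V; V \<subseteq> U; s \<in> sections E U\<rbrakk>
          \<Longrightarrow> res E V W (res E U V s) = res E U W s"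
    and glue: "\<lbrakk>\<And>U. U \<in> \<U> \<Longrightarrow> openin T U; \<And>U. U \<in> \<U> \<Longrightarrow> t U \<in> sections E U;
          \<And>U V. \<lbrakk>U \<in> \<U>; V \<in> \<U>\<rbrakk> \<Longrightarrow> res E U (U \<inter> V) (t U) = res E V (U \<inter> V) (t V)\<rbrakk>
          \<Longrightarrow> \<exists>!s. s \<in> sections E (\<Union>\<U>) \<and> (\<forall>U\<in>\<U>. res E (\<Union>\<U>) U s = t U)"

definition H_meet ::
  "('y, 's) presheaf \<Rightarrow> 'y set \<times> 's \<Rightarrow> 'y set \<times> 's \<Rightarrow> 'y set \<times> 's" where
  "H_meet E = (\<lambda>(U, s) (V, t). (U \<inter> V, res E U (U \<inter> V) s))"

definition H_join ::
  "('y, 's) presheaf \<Rightarrow> 'y set \<times> 's \<Rightarrow> 'y set \<times> 's \<Rightarrow> 'y set \<times> 's" where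
  "H_join E = (\<lambda>(U, s) (V, t).
     (U \<union> V, THE r. r \<in> sections E (U \<union> V) \<and>
        res E (U \<union> V) (U - V) r = res E U (U - V) s \<and> res E (U \<union> V) V r = t))"

definition H :: "'y topology \<Rightarrow> ('y, 's) presheaf \<Rightarrow> ('y set \<times> 's) skew_algebra" where
  "H Y E =
     \<lparr>carrier = {(U, s). openin Y U \<and> s \<in> sections E U},
      skew_meet = H_meet E, skew_join = H_join E,
      skew_zero = ({}, THE s. s \<in> sections E {})\<rparr>"

definition spatial_ncframe :: "'y itself \<Rightarrow> 's itself \<Rightarrow> 'b skew_algebra \<Rightarrow> bool" where
  "spatial_ncframe _ _ B \<longleftrightarrow> noncommutative_frame B \<and> left_handed B \<and>
     (\<exists>(Y :: 'y topology) (E :: ('y, 's) presheaf).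
        sheaf (front Y) E \<and> sections E (topspace Y) \<noteq> {} \<and> ncframe_iso B (H Y E))"


section \<open>The pair G(A) and the natural map\<close>

type_synonym 'a point = "'a set \<Rightarrow> bool"
type_synonym 'a germ = "'a point \<times> 'a set"
type_synonym 'a germ_section = "'a point \<Rightarrow> 'a germ"

text \<open>Points are extensional functions, so that equality of points is equality on \<open>A/\<D>\<close>.\<close>

definition points :: "'a skew_algebra \<Rightarrow> 'a point set" where
  "points A = {p \<in> extensional (carrier (shadow A)). frame_hom (shadow A) two p}"

definition basic_open :: "'a skew_algebra \<Rightarrow> 'a \<Rightarrow> 'a point set" where
  "basic_open A a = {p \<in> points A. p (Dclass A a)}"

definition Y_of :: "'a skew_algebra \<Rightarrow> 'a point topology" where
  "Y_of A = topology (\<lambda>U. \<exists>a\<in>carrier A. U = basic_open A a)"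

lemma openin_Y_of:
  assumes "frame (shadow A)"
  shows "openin (Y_of A) U \<longleftrightarrow> (\<exists>a\<in>carrier A. U = basic_open A a)"
proof -
  interpret L: frame "shadow A" by fact
  let ?O = "\<lambda>U. \<exists>a\<in>carrier A. U = basic_open A a"
  have cs: "carrier (shadow A) = Dclass A ` carrier A"
    by (auto simp: shadow_def quotient_def)
  have O: "?O U \<longleftrightarrow> (\<exists>X\<in>carrier (shadow A). U = {p \<in> points A. p X})" for U
    unfolding cs by (simp add: basic_open_def)
  have "istopology ?O"
    unfolding istopology_def
  proof (intro conjI allI impI)
    fix U V assume "?O U" "?O V"
    then obtain X Y where *: "X\<in>carrier (shadow A)" "U = {p \<in> points A. p X}"
       "Y\<in>carrier (shadow A)" "V = {p \<in> points A. p Y}" unfolding O by blast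
    then have "U \<inter> V = {p \<in> points A. p (X \<sqinter>\<^bsub>shadow A\<^esub> Y)}"
      by (auto simp: points_def frame_hom_def meet_two)
    then show "?O (U \<inter> V)" unfolding O using L.meet_closed[OF *(1,3)] by (intro bexI)
  next
    fix K assume K: "\<forall>U\<in>K. ?O U"
    define Q where "Q X = {p \<in> points A. p X}" for X
    define S where "S = {X\<in>carrier (shadow A). Q X \<in> K}"
    have S: "S \<subseteq> carrier (shadow A)" unfolding S_def by auto
    have p: "p (\<Squnion>\<^bsub>shadow A\<^esub> S) = (\<exists>X\<in>S. p X)" if "p \<in> points A" for p
    proof -
      have "\<forall>X. X \<subseteq> carrier (shadow A) \<longrightarrow> p (\<Squnion>\<^bsub>shadow A\<^esub>X) = \<Squnion>\<^bsub>two\<^esub>(p ` X)"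
        using that unfolding points_def frame_hom_def by simp
      then show ?thesis using S by (simp add: sup_two)
    qed
    have e: "\<exists>X\<in>S. U = Q X" if "U \<in> K" for U
    proof -
      obtain X where "X \<in> carrier (shadow A)" "U = Q X" 
        using K \<open>U \<in> K\<close> unfolding O Q_def by metis
      then show ?thesis using \<open>U \<in> K\<close> unfolding S_def by auto
    qed
    have "\<Union>K = (\<Union>X\<in>S. Q X)"
    proof
      show "\<Union>K \<subseteq> (\<Union>X\<in>S. Q X)" using e by (metis UN_upper Sup_least)
    qed (auto simp: S_def)
    also have "\<dots> = {p \<in> points A. p (\<Squnion>\<^bsub>shadow A\<^esub> S)}"
      using p by (auto simp: Q_def)
    finally show "?O (\<Union>K)" unfolding O using L.sup_closed[OF S] by (intro bexI)
  qed
  then show ?thesis by (simp add: Y_of_def topology_inverse')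
qed

definition germ_rel :: "'a skew_algebra \<Rightarrow> 'a point \<Rightarrow> ('a \<times> 'a) set" where
  "germ_rel A p = {(a, b). a \<in> carrier A \<and> b \<in> carrier A \<and> p (Dclass A a) \<and> p (Dclass A b) \<and>
     (\<exists>c\<in>carrier A. \<exists>d\<in>carrier A. \<not> p (Dclass A c) \<and> p (Dclass A d) \<and>
        (a \<^bold>\<and>\<^bsub>A\<^esub> d) \<^bold>\<or>\<^bsub>A\<^esub> c = (b \<^bold>\<and>\<^bsub>A\<^esub> d) \<^bold>\<or>\<^bsub>A\<^esub> c)}"

definition germ_section :: "'a skew_algebra \<Rightarrow> 'a \<Rightarrow> 'a germ_section" where
  "germ_section A a = (\<lambda>p\<in>basic_open A a. (p, germ_rel A p `` {a}))"

text \<open>The underlying set is \<open>{(p, [a]) | p(a) = 1}\<close>, the union of the generating sets.\<close>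

definition E_space :: "'a skew_algebra \<Rightarrow> 'a germ topology" where
  "E_space A = topology_generated_by
     {germ_section A a ` Z | a Z.
        a \<in> carrier A \<and> Z \<subseteq> basic_open A a \<and> locally_closed_in (Y_of A) Z}"

text \<open>The projection \<open>\<pi>\<^sub>A\<close> is \<^const>\<open>fst\<close>.\<close>

definition E_sheaf :: "'a skew_algebra \<Rightarrow> ('a point, 'a germ_section) presheaf" where
  "E_sheaf A =
     \<lparr>sections = (\<lambda>U. {s \<in> extensional U.
        continuous_map (subtopology (front (Y_of A)) U) (E_space A) s \<and> (\<forall>p\<in>U. fst (s p) = p)}),
      res = (\<lambda>U V s. restrict s V)\<rparr>"

definition HG :: "'a skew_algebra \<Rightarrow> ('a point set \<times> 'a germ_section) skew_algebra" where
  "HG A = H (Y_of A) (E_sheaf A)"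

text \<open>The natural map \<open>A \<rightarrow> H(G(A))\<close>.\<close>

definition sigma :: "'a skew_algebra \<Rightarrow> 'a \<Rightarrow> 'a point set \<times> 'a germ_section" where
  "sigma A a = (basic_open A a, germ_section A a)"


section \<open>The embedding conditions\<close>

text \<open>The existentially quantified algebra, space, sheaf and sets range over the types passed as
  arguments.\<close>

definition embeds_in_spatial ::
  "'b itself \<Rightarrow> 'y itself \<Rightarrow> 's itself \<Rightarrow> 'a skew_algebra \<Rightarrow> bool" where
  "embeds_in_spatial _ _ _ A \<longleftrightarrow>
     (\<exists>(B :: 'b skew_algebra) f. spatial_ncframe TYPE('y) TYPE('s) B \<and>
        ncframe_hom A B f \<and> inj_on f (carrier A))"

definition embeds_in_partial_functions ::
  "'r itself \<Rightarrow> 's itself \<Rightarrow> 'a skew_algebra \<Rightarrow> bool" where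
  "embeds_in_partial_functions _ _ A \<longleftrightarrow>
     (\<exists>(R :: 'r set) (S :: 's set) f. ncframe_hom A (partial_functions R S) f \<and>
        inj_on f (carrier A))"

end

theory Submission
  imports Defs
begin

text \<open>
  All four conditions amount to saying that distinct \<open>\<D>\<close>-equivalent elements of \<open>A\<close> are separated by
  evaluations: maps \<open>e\<close> into an option type that behave like the evaluation of partial functions
  at a point. An evaluation that separates two such elements becomes, after a two-valued test on its
  values, a morphism into the primitive algebra \<open>{0, 1\<^sub>a, 1\<^sub>b}\<close>, and every such morphism is an evaluation
  (\<open>hom_to_primitive_if_evaluation_separates\<close>, \<open>evaluation_prim_value\<close>). Evaluations can be pulled
  back along morphisms (\<open>evaluation_compose\<close>).

  Embeddings give evaluations. In \<open>\<P>(R, S)\<close> these are the evaluations at the elements of \<open>R\<close>. In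
  \<open>H(Y, E)\<close> two different sections over the same open set have different germs at some point of
  \<open>Y\<close>, and comparing the germ at that point with a fixed one is an evaluation
  (\<open>evaluation_same_germ\<close>, \<open>separated_by_germ\<close>). So \<open>c3\<close> and \<open>c4\<close> each imply \<open>c1\<close>, whatever the
  types of the algebras and spaces involved.

  Conversely, the germ of \<open>a\<close> at a point \<open>p\<close> of \<open>A/\<D>\<close> is an evaluation in \<open>a\<close>
  (\<open>evaluation_germ_section\<close>). Hence \<open>\<sigma>\<close>, read with values in all functions on \<open>Y\<^sub>A\<close>, and the map sending
  \<open>a\<close> to the partial function \<open>s\<^sub>a\<close>, are morphisms into \<open>H(Y\<^sub>A, F)\<close> for the sheaf \<open>F\<close> of all
  functions and into a \<open>\<P>(R, S)\<close>; that a map into such an algebra is a morphism can be checked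
  coordinatewise (\<open>ncframe_homI\<close>). If \<open>\<sigma>\<close> is injective, so are these two maps, and \<open>c2\<close> implies
  \<open>c3\<close> and \<open>c4\<close>.

  It remains to see that \<open>c1\<close> implies \<open>c2\<close>. Spatiality of \<open>A/\<D>\<close> ensures that elements with the same
  domain \<open>U\<^sub>a\<close> are \<open>\<D>\<close>-equivalent. A morphism \<open>q\<close> separating two such elements has as its support a
  point of \<open>A/\<D>\<close> (\<open>evaluation_support_is_point\<close>), and the germs at this point already determine
  the value of \<open>q\<close>; so \<open>\<sigma>\<close> separates the elements as well. That the support is a point needs every family
  of \<open>\<D>\<close>-classes to have commuting representatives, which follows from left normality,
  \<open>x \<^bold>\<and> y \<^bold>\<and> z = x \<^bold>\<and> z \<^bold>\<and> y\<close>, a consequence of strong distributivity.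
\<close>

section \<open>Left-handed skew lattices and their shadow\<close>

lemma le_natural_order: "le (natural_order A) a b \<longleftrightarrow> a \<^bold>\<and>\<^bsub>A\<^esub> b = a \<and> b \<^bold>\<and>\<^bsub>A\<^esub> a = a"
  by (simp add: natural_order_def)

lemma is_lub_natural_order:
  assumes "X \<subseteq> carrier A"
  shows "is_lub (natural_order A) s X \<longleftrightarrow>
    s \<in> carrier A \<and> (\<forall>x\<in>X. x \<^bold>\<and>\<^bsub>A\<^esub> s = x \<and> s \<^bold>\<and>\<^bsub>A\<^esub> x = x) \<and>
    (\<forall>u\<in>carrier A. (\<forall>x\<in>X. x \<^bold>\<and>\<^bsub>A\<^esub> u = x \<and> u \<^bold>\<and>\<^bsub>A\<^esub> x = x) \<longrightarrow> s \<^bold>\<and>\<^bsub>A\<^esub> u = s \<and> u \<^bold>\<and>\<^bsub>A\<^esub> s = s)"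
proof -
  have "carrier (natural_order A) = carrier A" by (simp add: natural_order_def)
  then show ?thesis
    using assms unfolding least_def Upper_def le_natural_order by blast
qed

locale left_handed_skew_lattice = skew_lattice +
  assumes left_handed: "left_handed A"
begin

lemma meet_meet_left:
  "\<lbrakk>x \<in> carrier A; y \<in> carrier A\<rbrakk> \<Longrightarrow> (x \<^bold>\<and> y) \<^bold>\<and> x = x \<^bold>\<and> y"
  using left_handed meet_assoc by (simp add: left_handed_def)

text \<open>Left-handedness is a law about meets; absorption transports it to joins, where it says that of two
  occurrences of \<open>x\<close> the right one counts. Applied to \<open>x\<close> and \<open>y \<^bold>\<or> x\<close> it gives
  \<open>x \<^bold>\<and> (y \<^bold>\<or> x) = x \<^bold>\<and> (y \<^bold>\<or> x) \<^bold>\<and> x = x\<close>.\<close>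

lemma join_join_right:
  assumes x: "x \<in> carrier A" and y: "y \<in> carrier A"
  shows "x \<^bold>\<or> (y \<^bold>\<or> x) = y \<^bold>\<or> x"
proof -
  have z: "y \<^bold>\<or> x \<in> carrier A" using join_closed[OF y x] .
  have "x \<^bold>\<and> (y \<^bold>\<or> x) = (x \<^bold>\<and> (y \<^bold>\<or> x)) \<^bold>\<and> x" using meet_meet_left[OF x z] by simp
  also have "\<dots> = x" using absorb4[OF y x] meet_assoc[OF x z x] meet_idem[OF x] by simp
  finally have "x \<^bold>\<and> (y \<^bold>\<or> x) = x" .
  then show ?thesis using absorb3[OF x z] by simp
qed

text \<open>Under left-handedness the preorder whose symmetric part is \<open>\<D>\<close> is just \<open>x \<^bold>\<and> y = x\<close>, which
  also becomes the order of the shadow. All later arguments about \<open>A/\<D>\<close> use this form.\<close>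

lemma greenD_iff:
  "(a, b) \<in> greenD A \<longleftrightarrow> a \<in> carrier A \<and> b \<in> carrier A \<and> a \<^bold>\<and> b = a \<and> b \<^bold>\<and> a = b"
  using meet_meet_left meet_idem by (auto simp: greenD_def)

lemma meet_eq_left_trans:
  assumes "x \<in> carrier A" "y \<in> carrier A" "z \<in> carrier A" "x \<^bold>\<and> y = x" "y \<^bold>\<and> z = y"
  shows "x \<^bold>\<and> z = x"
  using meet_assoc[OF assms(1-3)] assms(4,5) by simp

lemma equiv_greenD: "equiv (carrier A) (greenD A)"
proof (rule equivI)
  show "refl_on (carrier A) (greenD A)"
    by (auto simp: refl_on_def greenD_iff meet_idem)
  show "sym (greenD A)" by (auto simp: sym_def greenD_iff)
  show "trans (greenD A)"
    by (rule transI) (metis greenD_iff meet_eq_left_trans)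
qed (auto simp: greenD_iff)

lemma Dclass_eq_iff:
  assumes "a \<in> carrier A" "b \<in> carrier A"
  shows "Dclass A a = Dclass A b \<longleftrightarrow> a \<^bold>\<and> b = a \<and> b \<^bold>\<and> a = b"
  using eq_equiv_class_iff[OF equiv_greenD assms] assms by (simp add: greenD_iff)

lemma meet_lower_of_factors:
  assumes c: "a \<in> carrier A" "b \<in> carrier A" "a' \<in> carrier A" "b' \<in> carrier A"
    and "a \<^bold>\<and> a' = a" "b \<^bold>\<and> b' = b"
  shows "(a \<^bold>\<and> b) \<^bold>\<and> (a' \<^bold>\<and> b') = a \<^bold>\<and> b"
proof -
  have ab: "a \<^bold>\<and> b \<in> carrier A" using c meet_closed by simp
  have "(a \<^bold>\<and> b) \<^bold>\<and> (a' \<^bold>\<and> b') = (((a \<^bold>\<and> b) \<^bold>\<and> a) \<^bold>\<and> a') \<^bold>\<and> b'"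
    using c ab meet_assoc meet_meet_left meet_closed by simp
  also have "\<dots> = (a \<^bold>\<and> b) \<^bold>\<and> b'"
    using c ab assms(5) meet_assoc[OF ab c(1) c(3)] meet_meet_left by simp
  also have "\<dots> = a \<^bold>\<and> b" using c assms(6) meet_assoc by simp
  finally show ?thesis .
qed

lemma shadow_meet_Dclass:
  assumes x: "x \<in> carrier A" and y: "y \<in> carrier A"
  shows "shadow_meet A (Dclass A x) (Dclass A y) = Dclass A (x \<^bold>\<and> y)"
proof -
  have "Dclass A (x' \<^bold>\<and> y') = Dclass A (x \<^bold>\<and> y)"
    if "x' \<in> Dclass A x" "y' \<in> Dclass A y" for x' y'
  proof -
    have *: "x' \<in> carrier A" "x \<^bold>\<and> x' = x" "x' \<^bold>\<and> x = x'" "y' \<in> carrier A" "y \<^bold>\<and> y' = y" "y' \<^bold>\<and> y = y'"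
      using that by (auto simp: greenD_iff)
    have "x' \<^bold>\<and> y' \<in> carrier A" "x \<^bold>\<and> y \<in> carrier A" using * x y meet_closed by simp_all
    then show ?thesis
      by (simp add: Dclass_eq_iff meet_lower_of_factors * x y)
  qed
  moreover have "x \<in> Dclass A x" "y \<in> Dclass A y"
    using x y meet_idem by (auto simp: greenD_iff)
  ultimately show ?thesis unfolding shadow_meet_def by blast
qed

lemma carrier_shadow: "carrier (shadow A) = Dclass A ` carrier A"
  by (auto simp: shadow_def quotient_def)

lemma Dclass_in_shadow: "x \<in> carrier A \<Longrightarrow> Dclass A x \<in> carrier (shadow A)"
  by (simp add: carrier_shadow)

lemma le_shadow_iff:
  assumes x: "x \<in> carrier A" and y: "y \<in> carrier A"
  shows "le (shadow A) (Dclass A x) (Dclass A y) \<longleftrightarrow> x \<^bold>\<and> y = x"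
proof -
  have "le (shadow A) (Dclass A x) (Dclass A y) \<longleftrightarrow> Dclass A (x \<^bold>\<and> y) = Dclass A x"
    using shadow_meet_Dclass[OF x y] by (simp add: shadow_def)
  also have "\<dots> \<longleftrightarrow> x \<^bold>\<and> y = x"
    using Dclass_eq_iff[OF meet_closed[OF x y] x] meet_meet_left[OF x y]
      meet_assoc[OF x x y] meet_idem[OF x] by auto
  finally show ?thesis .
qed

lemma maximal_Dclass_iff:
  "m \<in> maximal_Dclass A \<longleftrightarrow> m \<in> carrier A \<and> (\<forall>x\<in>carrier A. x \<^bold>\<and> m = x)"
  by (auto simp: maximal_Dclass_def greatest_def carrier_shadow le_shadow_iff)

end

locale left_handed_frame = noncommutative_frame + left_handed_skew_lattice
begin

lemma distrib_right:
  "\<lbrakk>x \<in> carrier A; y \<in> carrier A; z \<in> carrier A\<rbrakk> \<Longrightarrow> (x \<^bold>\<or> y) \<^bold>\<and> z = (x \<^bold>\<and> z) \<^bold>\<or> (y \<^bold>\<and> z)"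
  using strongly_distributive by (simp add: strongly_distributive_def)

lemma distrib_left:
  "\<lbrakk>x \<in> carrier A; y \<in> carrier A; z \<in> carrier A\<rbrakk> \<Longrightarrow> x \<^bold>\<and> (y \<^bold>\<or> z) = (x \<^bold>\<and> y) \<^bold>\<or> (x \<^bold>\<and> z)"
  using strongly_distributive by (simp add: strongly_distributive_def)

lemma zero_meet: "x \<in> carrier A \<Longrightarrow> \<^bold>0 \<^bold>\<and> x = \<^bold>0"
  using absorb1[OF zero_closed] zero_left by metis

lemma meet_zero: "x \<in> carrier A \<Longrightarrow> x \<^bold>\<and> \<^bold>0 = \<^bold>0"
  using absorb4[OF _ zero_closed] zero_right by metis

text \<open>Two \<open>\<D>\<close>-equivalent elements \<open>u, v\<close> below a common \<open>x\<close> coincide, because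
  \<open>x \<^bold>\<or> u = x\<close> gives \<open>v = (x \<^bold>\<or> u) \<^bold>\<and> v = v \<^bold>\<or> u = u\<close>. Both \<open>x \<^bold>\<and> y \<^bold>\<and> z\<close> and \<open>x \<^bold>\<and> z \<^bold>\<and> y\<close> are such.\<close>

lemma eq_if_below_and_equivalent:
  assumes c: "x \<in> carrier A" "u \<in> carrier A" "v \<in> carrier A"
    and "u \<^bold>\<and> x = u" "x \<^bold>\<and> u = u" "x \<^bold>\<and> v = v" "u \<^bold>\<and> v = u" "v \<^bold>\<and> u = v"
  shows "u = v"
proof -
  have "x \<^bold>\<or> u = x" using absorb2[OF c(1,2)] assms by simp
  moreover have "(x \<^bold>\<or> u) \<^bold>\<and> v = (x \<^bold>\<and> v) \<^bold>\<or> (u \<^bold>\<and> v)" using distrib_right c by simp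
  ultimately have "v = v \<^bold>\<or> u" using assms by simp
  also have "\<dots> = u" using absorb3[OF c(3,2)] assms by simp
  finally show ?thesis by simp
qed

lemma left_normal:
  assumes c: "x \<in> carrier A" "y \<in> carrier A" "z \<in> carrier A"
  shows "(x \<^bold>\<and> y) \<^bold>\<and> z = (x \<^bold>\<and> z) \<^bold>\<and> y"
proof -
  have cl: "p \<^bold>\<and> q \<in> carrier A" if "p \<in> carrier A" "q \<in> carrier A" for p q
    using that meet_closed by simp
  have repeat: "((p \<^bold>\<and> q) \<^bold>\<and> r) \<^bold>\<and> p = (p \<^bold>\<and> q) \<^bold>\<and> r" "((p \<^bold>\<and> q) \<^bold>\<and> r) \<^bold>\<and> q = (p \<^bold>\<and> q) \<^bold>\<and> r"
    if "p \<in> carrier A" "q \<in> carrier A" "r \<in> carrier A" for p q r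
    using that meet_assoc meet_meet_left cl by metis+
  have x_meet: "x \<^bold>\<and> ((x \<^bold>\<and> q) \<^bold>\<and> r) = (x \<^bold>\<and> q) \<^bold>\<and> r"
    if "q \<in> carrier A" "r \<in> carrier A" for q r
    using that c meet_assoc[symmetric] meet_idem cl by simp
  have meet3: "((x \<^bold>\<and> q) \<^bold>\<and> r) \<^bold>\<and> ((x \<^bold>\<and> r) \<^bold>\<and> q) = (x \<^bold>\<and> q) \<^bold>\<and> r"
    if qr: "q \<in> carrier A" "r \<in> carrier A" for q r
  proof -
    have "((x \<^bold>\<and> q) \<^bold>\<and> r) \<^bold>\<and> ((x \<^bold>\<and> r) \<^bold>\<and> q) = ((((x \<^bold>\<and> q) \<^bold>\<and> r) \<^bold>\<and> x) \<^bold>\<and> r) \<^bold>\<and> q"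
      using qr c cl meet_assoc by simp
    also have "\<dots> = (((x \<^bold>\<and> q) \<^bold>\<and> r) \<^bold>\<and> r) \<^bold>\<and> q" using repeat[OF c(1) qr] by simp
    also have "\<dots> = ((x \<^bold>\<and> q) \<^bold>\<and> r) \<^bold>\<and> q" using qr c cl meet_assoc meet_idem by simp
    also have "\<dots> = (x \<^bold>\<and> q) \<^bold>\<and> r" using repeat[OF c(1) qr] by simp
    finally show ?thesis .
  qed
  show ?thesis
    by (rule eq_if_below_and_equivalent[of x])
      (simp_all add: c cl repeat x_meet meet3)
qed

lemma meet_eq_if_equivalent:
  assumes c: "m \<in> carrier A" "x \<in> carrier A" "y \<in> carrier A"
    and "x \<^bold>\<and> y = x" "y \<^bold>\<and> x = y"
  shows "m \<^bold>\<and> x = m \<^bold>\<and> y"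
  using left_normal[OF c] meet_assoc[OF c] meet_assoc[OF c(1,3,2)] assms(4,5) by simp

text \<open>Below a fixed element meets commute by left normality; the two joins agree because \<open>x \<^bold>\<or> y\<close>
  and \<open>y \<^bold>\<or> x\<close> are \<open>\<D>\<close>-equivalent. So every family of \<open>\<D>\<close>-classes has representatives that
  form a commuting subset.\<close>

lemma meets_with_fixed_commute:
  assumes c: "m \<in> carrier A" "x \<in> carrier A" "y \<in> carrier A"
  shows "(m \<^bold>\<and> x) \<^bold>\<and> (m \<^bold>\<and> y) = (m \<^bold>\<and> y) \<^bold>\<and> (m \<^bold>\<and> x)"
    and "(m \<^bold>\<and> x) \<^bold>\<or> (m \<^bold>\<and> y) = (m \<^bold>\<and> y) \<^bold>\<or> (m \<^bold>\<and> x)"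
proof -
  have *: "(m \<^bold>\<and> p) \<^bold>\<and> (m \<^bold>\<and> q) = (m \<^bold>\<and> p) \<^bold>\<and> q" if "p \<in> carrier A" "q \<in> carrier A" for p q
    using that c meet_assoc meet_meet_left meet_closed by metis
  show "(m \<^bold>\<and> x) \<^bold>\<and> (m \<^bold>\<and> y) = (m \<^bold>\<and> y) \<^bold>\<and> (m \<^bold>\<and> x)"
    using left_normal[OF c] * c by simp
  have j: "(p \<^bold>\<or> q) \<^bold>\<and> (q \<^bold>\<or> p) = p \<^bold>\<or> q" if pq: "p \<in> carrier A" "q \<in> carrier A" for p q
  proof -
    have "p \<^bold>\<and> (q \<^bold>\<or> p) = p"
      using join_join_right[OF pq] absorb1[of p "q \<^bold>\<or> p"] pq join_closed by simp
    moreover have "q \<^bold>\<and> (q \<^bold>\<or> p) = q" using absorb1 pq by simp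
    ultimately show ?thesis using distrib_right pq join_closed by simp
  qed
  have "m \<^bold>\<and> (x \<^bold>\<or> y) = m \<^bold>\<and> (y \<^bold>\<or> x)"
    using meet_eq_if_equivalent[OF c(1) join_closed[OF c(2,3)] join_closed[OF c(3,2)]] j c by simp
  then show "(m \<^bold>\<and> x) \<^bold>\<or> (m \<^bold>\<and> y) = (m \<^bold>\<and> y) \<^bold>\<or> (m \<^bold>\<and> x)"
    using distrib_left c by simp
qed

end

section \<open>Evaluations\<close>

text \<open>An evaluation is a homomorphism into the left-handed primitive algebra on an arbitrary set of
  nonzero elements, \<open>None\<close> playing the role of zero: it sends an element to its value at one point,
  if it is defined there. For suprema it suffices to speak of the support, since \<open>x = s \<^bold>\<and> x\<close> forces
  \<open>e s = e x\<close> as soon as \<open>e x \<noteq> None\<close>.\<close>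

definition evaluation :: "'a skew_algebra \<Rightarrow> ('a \<Rightarrow> 'g option) \<Rightarrow> bool" where
  "evaluation A e \<longleftrightarrow>
     e \<^bold>0\<^bsub>A\<^esub> = None \<and>
     (\<forall>x\<in>carrier A. \<forall>y\<in>carrier A. e (x \<^bold>\<and>\<^bsub>A\<^esub> y) = (if e y = None then None else e x)) \<and>
     (\<forall>x\<in>carrier A. \<forall>y\<in>carrier A. e (x \<^bold>\<or>\<^bsub>A\<^esub> y) = (if e y = None then e x else e y)) \<and>
     (\<forall>X s. commuting_subset A X \<and> is_lub (natural_order A) s X \<and> e s \<noteq> None
        \<longrightarrow> (\<exists>x\<in>X. e x \<noteq> None))"

lemma evaluationI:
  assumes "e \<^bold>0\<^bsub>A\<^esub> = None"
    and "\<And>x y. \<lbrakk>x \<in> carrier A; y \<in> carrier A\<rbrakk> \<Longrightarrow> e (x \<^bold>\<and>\<^bsub>A\<^esub> y) = (if e y = None then None else e x)"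
    and "\<And>x y. \<lbrakk>x \<in> carrier A; y \<in> carrier A\<rbrakk> \<Longrightarrow> e (x \<^bold>\<or>\<^bsub>A\<^esub> y) = (if e y = None then e x else e y)"
    and "\<And>X s. \<lbrakk>commuting_subset A X; is_lub (natural_order A) s X; e s \<noteq> None\<rbrakk>
      \<Longrightarrow> \<exists>x\<in>X. e x \<noteq> None"
  shows "evaluation A e"
  unfolding evaluation_def
proof (intro conjI ballI allI impI)
  fix X s assume *: "commuting_subset A X \<and> is_lub (natural_order A) s X \<and> e s \<noteq> None"
  show "\<exists>x\<in>X. e x \<noteq> None" by (rule assms(4)[of X s]) (simp_all add: *)
qed (fact assms)+

lemma evaluation_zero: "evaluation A e \<Longrightarrow> e \<^bold>0\<^bsub>A\<^esub> = None"
  by (simp add: evaluation_def)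

lemma evaluation_meet:
  "\<lbrakk>evaluation A e; x \<in> carrier A; y \<in> carrier A\<rbrakk>
    \<Longrightarrow> e (x \<^bold>\<and>\<^bsub>A\<^esub> y) = (if e y = None then None else e x)"
  by (simp add: evaluation_def)

lemma evaluation_join:
  "\<lbrakk>evaluation A e; x \<in> carrier A; y \<in> carrier A\<rbrakk>
    \<Longrightarrow> e (x \<^bold>\<or>\<^bsub>A\<^esub> y) = (if e y = None then e x else e y)"
  by (simp add: evaluation_def)

lemma evaluation_lub_support:
  "\<lbrakk>evaluation A e; commuting_subset A X; is_lub (natural_order A) s X; e s \<noteq> None\<rbrakk>
    \<Longrightarrow> \<exists>x\<in>X. e x \<noteq> None"
  unfolding evaluation_def by blast

lemma evaluation_lub_eq:
  assumes e: "evaluation A e" and X: "commuting_subset A X" and s: "is_lub (natural_order A) s X"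
    and x: "x \<in> X" "e x \<noteq> None"
  shows "e s = e x"
proof -
  have "X \<subseteq> carrier A" using X by (simp add: commuting_subset_def)
  then have "s \<in> carrier A" "s \<^bold>\<and>\<^bsub>A\<^esub> x = x" "x \<in> carrier A"
    using s x(1) by (auto simp: is_lub_natural_order)
  then show ?thesis using evaluation_meet[OF e, of s x] x(2) by simp
qed

lemma evaluation_compose:
  assumes f: "ncframe_hom A B f" and e: "evaluation B e"
  shows "evaluation A (e \<circ> f)"
proof -
  have c: "f x \<in> carrier B" if "x \<in> carrier A" for x
    using f that by (auto simp: ncframe_hom_def)
  have m: "f (x \<^bold>\<and>\<^bsub>A\<^esub> y) = f x \<^bold>\<and>\<^bsub>B\<^esub> f y" "f (x \<^bold>\<or>\<^bsub>A\<^esub> y) = f x \<^bold>\<or>\<^bsub>B\<^esub> f y"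
    if "x \<in> carrier A" "y \<in> carrier A" for x y
    using f that by (simp_all add: ncframe_hom_def)
  have z: "f \<^bold>0\<^bsub>A\<^esub> = \<^bold>0\<^bsub>B\<^esub>" using f by (simp add: ncframe_hom_def)
  have "\<exists>x\<in>X. (e \<circ> f) x \<noteq> None"
    if X: "commuting_subset A X" and s: "is_lub (natural_order A) s X" and "(e \<circ> f) s \<noteq> None" for X s
  proof -
    have *: "x \<in> carrier A" if "x \<in> X" for x using X that by (auto simp: commuting_subset_def)
    have **: "x \<^bold>\<and>\<^bsub>A\<^esub> y = y \<^bold>\<and>\<^bsub>A\<^esub> x" "x \<^bold>\<or>\<^bsub>A\<^esub> y = y \<^bold>\<or>\<^bsub>A\<^esub> x" if "x \<in> X" "y \<in> X" for x y
      using X that unfolding commuting_subset_def by blast+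
    have "f x \<^bold>\<and>\<^bsub>B\<^esub> f y = f y \<^bold>\<and>\<^bsub>B\<^esub> f x \<and> f x \<^bold>\<or>\<^bsub>B\<^esub> f y = f y \<^bold>\<or>\<^bsub>B\<^esub> f x" if "x \<in> X" "y \<in> X" for x y
      using m[OF *[OF that(1)] *[OF that(2)]] m[OF *[OF that(2)] *[OF that(1)]] **[OF that] by metis
    moreover have "X \<noteq> {}" using X by (simp add: commuting_subset_def)
    ultimately have "commuting_subset B (f ` X)"
      using * c unfolding commuting_subset_def by blast
    moreover have "is_lub (natural_order B) (f s) (f ` X)"
      using f X s by (simp add: ncframe_hom_def)
    ultimately show ?thesis using evaluation_lub_support[OF e] that(3) by fastforce
  qed
  then show ?thesis
    unfolding evaluation_def
    using c m z evaluation_zero[OF e] evaluation_meet[OF e] evaluation_join[OF e] by auto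
qed

interpretation primitive: left_handed_skew_lattice primitive_skew
proof -
  have laws: "prim_meet x x = x" "prim_join x x = x"
    "prim_meet (prim_meet x y) z = prim_meet x (prim_meet y z)"
    "prim_join (prim_join x y) z = prim_join x (prim_join y z)"
    "prim_meet x (prim_join x y) = x" "prim_join x (prim_meet x y) = x"
    "prim_join (prim_meet x y) y = y" "prim_meet (prim_join x y) y = y"
    "prim_meet x (prim_meet y x) = prim_meet x y" for x y z
    by (cases x; cases y; cases z; simp)+
  show "left_handed_skew_lattice primitive_skew"
    by unfold_locales (simp_all add: primitive_skew_def left_handed_def laws)
qed

lemma primitive_skew_simps:
  "carrier primitive_skew = UNIV" "x \<^bold>\<and>\<^bsub>primitive_skew\<^esub> y = prim_meet x y"
  "x \<^bold>\<or>\<^bsub>primitive_skew\<^esub> y = prim_join x y" "\<^bold>0\<^bsub>primitive_skew\<^esub> = Zero"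
  by (simp_all add: primitive_skew_def)

definition prim_value :: "prim \<Rightarrow> bool option" where
  "prim_value x = (case x of Zero \<Rightarrow> None | OneA \<Rightarrow> Some True | OneB \<Rightarrow> Some False)"

lemma prim_value_simps [simp]:
  "prim_value Zero = None" "prim_value OneA = Some True" "prim_value OneB = Some False"
  by (simp_all add: prim_value_def)

lemma evaluation_prim_value: "evaluation primitive_skew prim_value"
proof -
  have "\<exists>x\<in>X. prim_value x \<noteq> None"
    if X: "commuting_subset primitive_skew X" and s: "is_lub (natural_order primitive_skew) s X"
      and "prim_value s \<noteq> None" for X s
  proof (rule ccontr)
    assume "\<not> (\<exists>x\<in>X. prim_value x \<noteq> None)"
    then have "x = Zero" if "x \<in> X" for x using that by (cases x) auto
    then have "\<forall>x\<in>X. prim_meet x Zero = x \<and> prim_meet Zero x = x"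
      by (metis prim_meet.simps(1))
    moreover have "X \<subseteq> carrier primitive_skew" by (simp add: primitive_skew_def)
    ultimately have "prim_meet s Zero = s"
      using s unfolding is_lub_natural_order[OF \<open>X \<subseteq> _\<close>] by (auto simp: primitive_skew_def)
    then show False using that(3) by simp
  qed
  moreover have "prim_value (prim_meet x y) = (if prim_value y = None then None else prim_value x)"
    "prim_value (prim_join x y) = (if prim_value y = None then prim_value x else prim_value y)" for x y
    by (cases x; cases y; simp)+
  ultimately show ?thesis
    unfolding evaluation_def by (auto simp: primitive_skew_simps)
qed

text \<open>An evaluation followed by a two-valued test on its values is a morphism into the primitive algebra.
  Maximal elements go to maximal ones because \<open>a = a \<^bold>\<and> m\<close> and \<open>e a \<noteq> None\<close> force \<open>e m \<noteq> None\<close>.\<close>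

lemma hom_to_primitive_if_evaluation_separates:
  assumes A: "left_handed_skew_lattice A" and e: "evaluation A e"
    and a: "a \<in> carrier A" "e a = Some u" and b: "e b = Some v" and "u \<noteq> v"
  shows "\<exists>q. ncframe_hom A primitive_skew q \<and> q a = OneA \<and> q b = OneB"
proof -
  interpret left_handed_skew_lattice A by fact
  define q where "q x = (case e x of None \<Rightarrow> Zero | Some w \<Rightarrow> if w = u then OneA else OneB)" for x
  have q0: "q x = Zero \<longleftrightarrow> e x = None" for x by (auto simp: q_def split: option.splits)
  have "is_lub (natural_order primitive_skew) (q s) (q ` X)"
    if X: "commuting_subset A X" and s: "is_lub (natural_order A) s X" for X s
  proof -
    have below: "q x = Zero \<or> q s = q x" if "x \<in> X" for x
    proof (cases "e x = None")
      case False
      then show ?thesis using evaluation_lub_eq[OF e X s that] by (simp add: q_def)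
    qed (simp add: q_def)
    have "\<exists>x\<in>X. q x \<noteq> Zero" if "q s \<noteq> Zero"
      using evaluation_lub_support[OF e X s] that q0 by metis
    then have least: "q s = Zero \<or> u = q s" if "\<forall>x\<in>X. q x = Zero \<or> u = q x" for u
      using that below by metis
    have pm: "prim_meet y z = y \<and> prim_meet z y = y \<longleftrightarrow> y = Zero \<or> z = y" for y z
      by (cases y; cases z) auto
    have "q ` X \<subseteq> carrier primitive_skew" by (simp add: primitive_skew_def)
    then show ?thesis
      using below least by (simp only: is_lub_natural_order) (simp add: primitive_skew_def pm)
  qed
  moreover have "q ` maximal_Dclass A \<subseteq> maximal_Dclass primitive_skew"
  proof
    fix z assume "z \<in> q ` maximal_Dclass A"
    then obtain m where m: "m \<in> maximal_Dclass A" "z = q m" by blast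
    then have "m \<in> carrier A" "a \<^bold>\<and>\<^bsub>A\<^esub> m = a" using a by (auto simp: maximal_Dclass_iff)
    then have "z \<noteq> Zero" using evaluation_meet[OF e a(1), of m] a(2) m(2) q0 by (auto split: if_splits)
    then have "prim_meet x z = x" for x by (cases z; cases x) auto
    then show "z \<in> maximal_Dclass primitive_skew"
      by (simp add: primitive.maximal_Dclass_iff) (simp add: primitive_skew_def)
  qed
  moreover have "q (x \<^bold>\<and>\<^bsub>A\<^esub> y) = prim_meet (q x) (q y)" "q (x \<^bold>\<or>\<^bsub>A\<^esub> y) = prim_join (q x) (q y)"
    if "x \<in> carrier A" "y \<in> carrier A" for x y
    using evaluation_meet[OF e that] evaluation_join[OF e that]
    by (auto simp: q_def split: option.splits)
  moreover have "q \<^bold>0\<^bsub>A\<^esub> = Zero" using evaluation_zero[OF e] q0 by simp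
  ultimately have "ncframe_hom A primitive_skew q"
    unfolding ncframe_hom_def by (auto simp: primitive_skew_def)
  moreover have "q a = OneA" "q b = OneB" using a b \<open>u \<noteq> v\<close> by (auto simp: q_def)
  ultimately show ?thesis by blast
qed

section \<open>Points of the shadow\<close>

lemma top_two: "\<top>\<^bsub>two\<^esub> = True"
proof -
  interpret complete_lattice two by (rule complete_lattice_two)
  have "le two True \<top>\<^bsub>two\<^esub>" by (rule top_higher) (simp add: two_def)
  then show ?thesis by (simp add: two_def)
qed

locale left_handed_frame_over_frame = left_handed_frame A + shadow: frame "shadow A"
  for A :: "'a skew_algebra" (structure)
begin

lemma shadow_meet_eq:
  assumes "x \<in> carrier A" "y \<in> carrier A"
  shows "Dclass A x \<sqinter>\<^bsub>shadow A\<^esub> Dclass A y = Dclass A (x \<^bold>\<and> y)"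
proof -
  let ?S = "{Dclass A x, Dclass A y}"
  have S: "?S \<subseteq> carrier (shadow A)" using assms by (simp add: carrier_shadow)
  have c: "x \<^bold>\<and> y \<in> carrier A" using assms meet_closed by simp
  have *: "(x \<^bold>\<and> y) \<^bold>\<and> x = x \<^bold>\<and> y" "(x \<^bold>\<and> y) \<^bold>\<and> y = x \<^bold>\<and> y"
    using assms meet_meet_left meet_assoc meet_idem by auto
  have "z \<^bold>\<and> (x \<^bold>\<and> y) = z" if "z \<in> carrier A" "z \<^bold>\<and> x = z" "z \<^bold>\<and> y = z" for z
    using meet_assoc[OF that(1) assms] that by simp
  then have "is_glb (shadow A) (Dclass A (x \<^bold>\<and> y)) ?S"
    using assms c * unfolding greatest_def Lower_def
    by (auto simp: carrier_shadow le_shadow_iff)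
  then show ?thesis
    using shadow.greatest_unique[OF shadow.inf_glb[OF S]] by (simp add: meet_def)
qed

lemma shadow_sup_eq:
  assumes S: "S \<subseteq> carrier A" and s: "s \<in> carrier A" "\<And>x. x \<in> S \<Longrightarrow> x \<^bold>\<and> s = x"
    "\<And>b. \<lbrakk>b \<in> carrier A; \<And>x. x \<in> S \<Longrightarrow> x \<^bold>\<and> b = x\<rbrakk> \<Longrightarrow> s \<^bold>\<and> b = s"
  shows "\<Squnion>\<^bsub>shadow A\<^esub> (Dclass A ` S) = Dclass A s"
proof -
  have S': "Dclass A ` S \<subseteq> carrier (shadow A)" using S by (auto simp: carrier_shadow)
  have "is_lub (shadow A) (Dclass A s) (Dclass A ` S)"
  proof -
    have "le (shadow A) (Dclass A s) Y" if Y: "Y \<in> Upper (shadow A) (Dclass A ` S)" for Y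
    proof -
      have "Y \<in> carrier (shadow A)" using that by (simp add: Upper_def)
      then obtain b where b: "b \<in> carrier A" "Y = Dclass A b"
        unfolding carrier_shadow by blast
      have "x \<^bold>\<and> b = x" if x: "x \<in> S" for x
      proof -
        have "x \<in> carrier A" using x S by blast
        moreover have "le (shadow A) (Dclass A x) (Dclass A b)"
          using Y b x \<open>x \<in> carrier A\<close> by (auto simp: Upper_def carrier_shadow)
        ultimately show ?thesis using b le_shadow_iff by blast
      qed
      then show ?thesis using s b le_shadow_iff by blast
    qed
    moreover have "le (shadow A) (Dclass A x) (Dclass A s)" if "x \<in> S" for x
      using S s that le_shadow_iff by blast
    then have "Dclass A s \<in> Upper (shadow A) (Dclass A ` S)"
      using s(1) by (auto simp: Upper_def carrier_shadow)
    moreover have "Upper (shadow A) (Dclass A ` S) \<subseteq> carrier (shadow A)" by (simp add: Upper_def)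
    ultimately show ?thesis unfolding least_def by blast
  qed
  then show ?thesis
    using shadow.least_unique[OF shadow.sup_lub[OF S']] by simp
qed

text \<open>Distributivity of \<open>\<^bold>\<and> b\<close> over the supremum identifies \<open>s \<^bold>\<and> b\<close> as another supremum of the same
  family. Hence suprema of commuting subsets induce suprema in the shadow.\<close>

lemma lub_below:
  assumes X: "commuting_subset A X" and s: "is_lub (natural_order A) s X"
    and b: "b \<in> carrier A" "\<And>x. x \<in> X \<Longrightarrow> x \<^bold>\<and> b = x"
  shows "s \<^bold>\<and> b = s"
proof -
  have X': "X \<subseteq> carrier A" using X by (simp add: commuting_subset_def)
  have sc: "s \<in> carrier A" using s by (simp add: is_lub_natural_order[OF X'])
  have "(\<lambda>x. x \<^bold>\<and> b) ` X = X" using b(2) by force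
  then have sb: "is_lub (natural_order A) (s \<^bold>\<and> b) X" using Sup_meet[OF X s b(1)] by simp
  have "s \<^bold>\<and> (s \<^bold>\<and> b) = s"
    using s sb unfolding is_lub_natural_order[OF X'] by blast
  then show ?thesis using meet_assoc[OF sc sc b(1)] meet_idem[OF sc] by simp
qed

lemma shadow_sup_lub:
  assumes X: "commuting_subset A X" and s: "is_lub (natural_order A) s X"
  shows "\<Squnion>\<^bsub>shadow A\<^esub> (Dclass A ` X) = Dclass A s"
proof -
  have X': "X \<subseteq> carrier A" using X by (simp add: commuting_subset_def)
  show ?thesis
    using s unfolding is_lub_natural_order[OF X']
    by (intro shadow_sup_eq[OF X'] lub_below[OF X s]) auto
qed

lemma shadow_sup_join:
  assumes xy: "x \<in> carrier A" "y \<in> carrier A"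
  shows "\<Squnion>\<^bsub>shadow A\<^esub> {Dclass A x, Dclass A y} = Dclass A (x \<^bold>\<or> y)"
proof -
  have "x \<^bold>\<and> (x \<^bold>\<or> y) = x" using absorb1 xy by simp
  moreover have "y \<^bold>\<and> (x \<^bold>\<or> y) = y"
    using join_join_right[OF xy(2,1)] absorb1[of y "x \<^bold>\<or> y"] xy join_closed by simp
  moreover have "(x \<^bold>\<or> y) \<^bold>\<and> b = x \<^bold>\<or> y" if "b \<in> carrier A" "x \<^bold>\<and> b = x" "y \<^bold>\<and> b = y" for b
    using distrib_right that xy by simp
  ultimately show ?thesis
    using shadow_sup_eq[of "{x, y}" "x \<^bold>\<or> y"] xy join_closed by auto
qed

lemma shadow_sup_empty: "\<Squnion>\<^bsub>shadow A\<^esub> {} = Dclass A \<^bold>0"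
  using shadow_sup_eq[of "{}" "\<^bold>0"] zero_closed zero_meet by simp

lemma shadow_top:
  assumes m: "m \<in> maximal_Dclass A"
  shows "\<top>\<^bsub>shadow A\<^esub> = Dclass A m"
  using m shadow.greatest_unique[OF shadow.top_greatest] by (auto simp: maximal_Dclass_def)

lemma maximal_exists: "\<exists>m. m \<in> maximal_Dclass A"
proof -
  obtain m where "m \<in> carrier A" "\<top>\<^bsub>shadow A\<^esub> = Dclass A m"
    using shadow.top_closed by (auto simp: carrier_shadow)
  then show ?thesis using shadow.top_greatest by (auto simp: maximal_Dclass_def)
qed

lemma
  assumes p: "p \<in> points A"
  shows point_meet: "\<lbrakk>x \<in> carrier A; y \<in> carrier A\<rbrakk>
      \<Longrightarrow> p (Dclass A (x \<^bold>\<and> y)) \<longleftrightarrow> p (Dclass A x) \<and> p (Dclass A y)"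
    and point_join: "\<lbrakk>x \<in> carrier A; y \<in> carrier A\<rbrakk>
      \<Longrightarrow> p (Dclass A (x \<^bold>\<or> y)) \<longleftrightarrow> p (Dclass A x) \<or> p (Dclass A y)"
    and point_zero: "\<not> p (Dclass A \<^bold>0)"
    and point_maximal: "m \<in> maximal_Dclass A \<Longrightarrow> p (Dclass A m)"
    and point_lub: "\<lbrakk>commuting_subset A X; is_lub (natural_order A) s X\<rbrakk>
      \<Longrightarrow> p (Dclass A s) \<longleftrightarrow> (\<exists>x\<in>X. p (Dclass A x))"
proof -
  have top: "p \<top>\<^bsub>shadow A\<^esub>"
    and meet: "\<And>X Y. \<lbrakk>X \<in> carrier (shadow A); Y \<in> carrier (shadow A)\<rbrakk> \<Longrightarrow> p (X \<sqinter>\<^bsub>shadow A\<^esub> Y) \<longleftrightarrow> p X \<and> p Y"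
    and sup: "\<And>X. X \<subseteq> carrier (shadow A) \<Longrightarrow> p (\<Squnion>\<^bsub>shadow A\<^esub> X) \<longleftrightarrow> (\<exists>x\<in>X. p x)"
    using p by (auto simp: points_def frame_hom_def meet_two sup_two top_two)
  show "p (Dclass A (x \<^bold>\<and> y)) \<longleftrightarrow> p (Dclass A x) \<and> p (Dclass A y)"
    if "x \<in> carrier A" "y \<in> carrier A"
    using meet[OF Dclass_in_shadow[OF that(1)] Dclass_in_shadow[OF that(2)]] shadow_meet_eq[OF that] by simp
  show "p (Dclass A (x \<^bold>\<or> y)) \<longleftrightarrow> p (Dclass A x) \<or> p (Dclass A y)"
    if "x \<in> carrier A" "y \<in> carrier A"
    using sup[of "{Dclass A x, Dclass A y}"] Dclass_in_shadow that shadow_sup_join[OF that] by simp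
  show "\<not> p (Dclass A \<^bold>0)" using sup[of "{}"] shadow_sup_empty by simp
  show "p (Dclass A m)" if "m \<in> maximal_Dclass A" using top shadow_top[OF that] by simp
  show "p (Dclass A s) \<longleftrightarrow> (\<exists>x\<in>X. p (Dclass A x))"
    if X: "commuting_subset A X" "is_lub (natural_order A) s X"
  proof -
    have "Dclass A ` X \<subseteq> carrier (shadow A)"
      using X by (auto simp: commuting_subset_def carrier_shadow)
    then show ?thesis using sup[of "Dclass A ` X"] shadow_sup_lub[OF X] by simp
  qed
qed

lemma commuting_representatives:
  assumes m: "m \<in> maximal_Dclass A" and S: "S \<subseteq> carrier A"
  shows "commuting_subset A (insert \<^bold>0 ((\<lambda>x. m \<^bold>\<and> x) ` S))"
proof -
  have mc: "m \<in> carrier A" using m by (simp add: maximal_Dclass_iff)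
  \<comment> \<open>Zero is adjoined because a commuting subset must be nonempty, while \<open>S\<close> may be empty.\<close>
  have "insert \<^bold>0 ((\<lambda>x. m \<^bold>\<and> x) ` S) = (\<lambda>x. m \<^bold>\<and> x) ` insert \<^bold>0 S"
    using meet_zero[OF mc] by simp
  moreover have "commuting_subset A ((\<lambda>x. m \<^bold>\<and> x) ` insert \<^bold>0 S)"
    using meets_with_fixed_commute[OF mc] S zero_closed meet_closed[OF mc]
    unfolding commuting_subset_def by (auto simp: subset_iff)
  ultimately show ?thesis by simp
qed

text \<open>Of the laws of a frame homomorphism only suprema need an argument: a family of
  \<open>\<D>\<close>-classes has representatives \<open>m \<^bold>\<and> x\<close> below a maximal \<open>m\<close>, these commute, and the class
  of their supremum in \<open>A\<close> is the supremum of the classes.\<close>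

lemma evaluation_support_is_point:
  assumes e: "evaluation A e" and a: "a \<in> carrier A" "e a \<noteq> None"
  shows "\<exists>p\<in>points A. \<forall>x\<in>carrier A. p (Dclass A x) \<longleftrightarrow> e x \<noteq> None"
proof -
  define p where "p = (\<lambda>X\<in>carrier (shadow A). \<exists>x\<in>X. e x \<noteq> None)"
  have pD: "p (Dclass A x) \<longleftrightarrow> e x \<noteq> None" if x: "x \<in> carrier A" for x
  proof -
    have "e y \<noteq> None \<Longrightarrow> e x \<noteq> None" if "y \<in> Dclass A x" for y
      using that x evaluation_meet[OF e, of y x] by (auto simp: greenD_iff split: if_splits)
    moreover have "x \<in> Dclass A x" using x meet_idem by (simp add: greenD_iff)
    ultimately show ?thesis using x by (auto simp: p_def Dclass_in_shadow)
  qed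
  obtain m where m: "m \<in> maximal_Dclass A" using maximal_exists by blast
  then have mc: "m \<in> carrier A" and xm: "\<And>x. x \<in> carrier A \<Longrightarrow> x \<^bold>\<and> m = x"
    by (auto simp: maximal_Dclass_iff)
  have em: "e m \<noteq> None"
    using evaluation_meet[OF e a(1) mc] xm[OF a(1)] a(2) by (auto split: if_splits)
  have "p (\<Squnion>\<^bsub>shadow A\<^esub> Q) = (\<exists>X\<in>Q. p X)" if Q: "Q \<subseteq> carrier (shadow A)" for Q
  proof -
    define S where "S = {x \<in> carrier A. Dclass A x \<in> Q}"
    have S: "S \<subseteq> carrier A" "Q = Dclass A ` S" using Q by (auto simp: S_def carrier_shadow)
    let ?X = "insert \<^bold>0 ((\<lambda>x. m \<^bold>\<and> x) ` S)"
    have X: "commuting_subset A ?X" using commuting_representatives[OF m S(1)] .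
    then have X': "?X \<subseteq> carrier A" by (simp add: commuting_subset_def)
    obtain s where s: "is_lub (natural_order A) s ?X"
      using join_complete X by (auto simp: join_complete_def)
    have sc: "s \<in> carrier A" using s unfolding is_lub_natural_order[OF X'] by blast
    have sx: "x \<^bold>\<and> (m \<^bold>\<and> x) = x" if "x \<in> S" for x
      using that S(1) xm mc meet_assoc[of x m x] meet_idem by auto
    have "\<Squnion>\<^bsub>shadow A\<^esub> Q = Dclass A s"
      unfolding S(2)
    proof (rule shadow_sup_eq[OF S(1) sc])
      fix x assume x: "x \<in> S"
      have "(m \<^bold>\<and> x) \<^bold>\<and> s = m \<^bold>\<and> x" using s x unfolding is_lub_natural_order[OF X'] by blast
      then show "x \<^bold>\<and> s = x"
        using meet_eq_left_trans[of x "m \<^bold>\<and> x" s] sx[OF x] x S(1) sc mc meet_closed by auto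
    next
      fix b assume b: "b \<in> carrier A" "\<And>x. x \<in> S \<Longrightarrow> x \<^bold>\<and> b = x"
      have "(m \<^bold>\<and> x) \<^bold>\<and> b = m \<^bold>\<and> x" if "x \<in> S" for x
        using meet_assoc[of m x b] b mc that S(1) by auto
      then show "s \<^bold>\<and> b = s"
        using lub_below[OF X s b(1)] zero_meet[OF b(1)] by auto
    qed
    then have "p (\<Squnion>\<^bsub>shadow A\<^esub> Q) \<longleftrightarrow> e s \<noteq> None" using pD[OF sc] by simp
    also have "\<dots> \<longleftrightarrow> (\<exists>x\<in>?X. e x \<noteq> None)"
      using evaluation_lub_support[OF e X s] evaluation_lub_eq[OF e X s] by metis
    also have "\<dots> \<longleftrightarrow> (\<exists>x\<in>S. e x \<noteq> None)"
    proof -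
      have "e (m \<^bold>\<and> x) \<noteq> None \<longleftrightarrow> e x \<noteq> None" if "x \<in> S" for x
        using evaluation_meet[OF e mc subsetD[OF S(1) that]] em by simp
      then show ?thesis using evaluation_zero[OF e] by (simp only: bex_simps image_iff) auto
    qed
    also have "\<dots> \<longleftrightarrow> (\<exists>x\<in>S. p (Dclass A x))"
      using pD S(1) by (intro bex_cong) auto
    also have "\<dots> \<longleftrightarrow> (\<exists>X\<in>Q. p X)" by (simp add: S(2))
    finally show ?thesis .
  qed
  moreover have "p (X \<sqinter>\<^bsub>shadow A\<^esub> Y) = (p X \<and> p Y)"
    if XY: "X \<in> carrier (shadow A)" "Y \<in> carrier (shadow A)" for X Y
  proof -
    obtain x y where *: "x \<in> carrier A" "y \<in> carrier A" "X = Dclass A x" "Y = Dclass A y"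
      using XY by (auto simp: carrier_shadow)
    then show ?thesis
      using evaluation_meet[OF e *(1,2)] by (simp add: shadow_meet_eq pD meet_closed)
  qed
  moreover have "p \<top>\<^bsub>shadow A\<^esub> = \<top>\<^bsub>two\<^esub>" using shadow_top[OF m] pD[OF mc] em top_two by simp
  ultimately have "p \<in> points A"
    unfolding points_def frame_hom_def
    by (auto simp: p_def two_def meet_two[unfolded two_def] sup_two[unfolded two_def])
  then show ?thesis using pD by blast
qed

end

section \<open>Germs\<close>

context left_handed_frame_over_frame
begin

lemma germ_relI:
  assumes "a \<in> carrier A" "b \<in> carrier A" "c \<in> carrier A" "d \<in> carrier A"
    and "p (Dclass A a)" "p (Dclass A b)" "\<not> p (Dclass A c)" "p (Dclass A d)"
    and "(a \<^bold>\<and> d) \<^bold>\<or> c = (b \<^bold>\<and> d) \<^bold>\<or> c"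
  shows "(a, b) \<in> germ_rel A p"
  using assms unfolding germ_rel_def by blast

text \<open>Transitivity is the only issue. Let \<open>c, d\<close> witness the first and \<open>c', d'\<close> the second relation. Both
  equations survive meeting with a further element by \<open>shrink\<close>, so \<open>d\<close> and \<open>d'\<close> can be replaced by
  \<open>d \<^bold>\<and> d'\<close>; as joining on the right overrides, \<open>c \<^bold>\<or> c'\<close> can then replace both \<open>c\<close> and \<open>c'\<close>.\<close>

lemma equiv_germ_rel:
  assumes p: "p \<in> points A"
  shows "equiv {a \<in> carrier A. p (Dclass A a)} (germ_rel A p)"
proof (rule equivI)
  show "germ_rel A p \<subseteq> {a \<in> carrier A. p (Dclass A a)} \<times> {a \<in> carrier A. p (Dclass A a)}"
    by (auto simp: germ_rel_def)
  show "refl_on {a \<in> carrier A. p (Dclass A a)} (germ_rel A p)"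
  proof (rule refl_onI)
    fix a assume "a \<in> {a \<in> carrier A. p (Dclass A a)}"
    then show "(a, a) \<in> germ_rel A p"
      using germ_relI[of a a "\<^bold>0" a p] point_zero[OF p] zero_closed by simp
  qed
  show "sym (germ_rel A p)" by (rule symI) (auto simp: germ_rel_def; metis)
  show "trans (germ_rel A p)"
  proof (rule transI)
    fix a b e assume ab: "(a, b) \<in> germ_rel A p" and be: "(b, e) \<in> germ_rel A p"
    obtain c d where 1: "a \<in> carrier A" "b \<in> carrier A" "c \<in> carrier A" "d \<in> carrier A"
      "p (Dclass A a)" "p (Dclass A b)" "\<not> p (Dclass A c)" "p (Dclass A d)"
      "(a \<^bold>\<and> d) \<^bold>\<or> c = (b \<^bold>\<and> d) \<^bold>\<or> c"
      using ab unfolding germ_rel_def by blast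
    obtain c' d' where 2: "e \<in> carrier A" "c' \<in> carrier A" "d' \<in> carrier A"
      "p (Dclass A e)" "\<not> p (Dclass A c')" "p (Dclass A d')"
      "(b \<^bold>\<and> d') \<^bold>\<or> c' = (e \<^bold>\<and> d') \<^bold>\<or> c'"
      using be unfolding germ_rel_def by blast
    have shrink: "(x \<^bold>\<and> (v \<^bold>\<and> w)) \<^bold>\<or> u = (y \<^bold>\<and> (v \<^bold>\<and> w)) \<^bold>\<or> u"
      if "x \<in> carrier A" "y \<in> carrier A" "u \<in> carrier A" "v \<in> carrier A" "w \<in> carrier A"
        and eq: "(x \<^bold>\<and> v) \<^bold>\<or> u = (y \<^bold>\<and> v) \<^bold>\<or> u" for x y u v w
    proof -
      have "(z \<^bold>\<and> (v \<^bold>\<and> w)) \<^bold>\<or> u = (((z \<^bold>\<and> v) \<^bold>\<or> u) \<^bold>\<and> w) \<^bold>\<or> u" if z: "z \<in> carrier A" for z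
      proof -
        have "(((z \<^bold>\<and> v) \<^bold>\<or> u) \<^bold>\<and> w) \<^bold>\<or> u = (((z \<^bold>\<and> v) \<^bold>\<and> w) \<^bold>\<or> (u \<^bold>\<and> w)) \<^bold>\<or> u"
          using distrib_right \<open>u \<in> _\<close> \<open>v \<in> _\<close> \<open>w \<in> _\<close> z meet_closed by simp
        also have "\<dots> = ((z \<^bold>\<and> v) \<^bold>\<and> w) \<^bold>\<or> ((u \<^bold>\<and> w) \<^bold>\<or> u)"
          using join_assoc \<open>u \<in> _\<close> \<open>v \<in> _\<close> \<open>w \<in> _\<close> z meet_closed by simp
        also have "(u \<^bold>\<and> w) \<^bold>\<or> u = u"
          using absorb3[of "u \<^bold>\<and> w" u] meet_meet_left[of u w] \<open>u \<in> _\<close> \<open>w \<in> _\<close> meet_closed by simp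
        finally show ?thesis using meet_assoc \<open>v \<in> _\<close> \<open>w \<in> _\<close> z by simp
      qed
      then show ?thesis using that eq by simp
    qed
    have dd: "d \<^bold>\<and> d' \<in> carrier A" "p (Dclass A (d \<^bold>\<and> d'))"
      using 1 2 meet_closed point_meet[OF p] by simp_all
    have cc: "c \<^bold>\<or> c' \<in> carrier A" "\<not> p (Dclass A (c \<^bold>\<or> c'))"
      using 1 2 join_closed point_join[OF p] by simp_all
    have m: "z \<^bold>\<and> (d \<^bold>\<and> d') \<in> carrier A" if "z \<in> carrier A" for z using that dd meet_closed by simp
    have swap: "z \<^bold>\<and> (d' \<^bold>\<and> d) = z \<^bold>\<and> (d \<^bold>\<and> d')" if "z \<in> carrier A" for z
      using left_normal[of z d d'] meet_assoc that 1 2 by simp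
    have ab': "(a \<^bold>\<and> (d \<^bold>\<and> d')) \<^bold>\<or> c = (b \<^bold>\<and> (d \<^bold>\<and> d')) \<^bold>\<or> c"
      using shrink[OF 1(1,2,3,4) 2(3) 1(9)] .
    have be': "(b \<^bold>\<and> (d \<^bold>\<and> d')) \<^bold>\<or> c' = (e \<^bold>\<and> (d \<^bold>\<and> d')) \<^bold>\<or> c'"
      using shrink[OF 1(2) 2(1,2,3) 1(4) 2(7)] swap 1 2 by simp
    \<comment> \<open>Joining with \<open>c \<^bold>\<or> c'\<close> on the right absorbs a previous join with \<open>c'\<close>.\<close>
    have cc': "c' \<^bold>\<or> (c \<^bold>\<or> c') = c \<^bold>\<or> c'" using join_join_right 1 2 by simp
    have "(a \<^bold>\<and> (d \<^bold>\<and> d')) \<^bold>\<or> (c \<^bold>\<or> c') = (b \<^bold>\<and> (d \<^bold>\<and> d')) \<^bold>\<or> (c \<^bold>\<or> c')"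
      using ab' join_assoc[OF m 1(3) 2(2), symmetric] 1 by simp
    also have "\<dots> = ((b \<^bold>\<and> (d \<^bold>\<and> d')) \<^bold>\<or> c') \<^bold>\<or> (c \<^bold>\<or> c')"
      using join_assoc[OF m 2(2) cc(1)] 1 cc' by simp
    also have "\<dots> = (e \<^bold>\<and> (d \<^bold>\<and> d')) \<^bold>\<or> (c \<^bold>\<or> c')"
      using join_assoc[OF m 2(2) cc(1)] 2 cc' be' by simp
    finally show "(a, e) \<in> germ_rel A p"
      using germ_relI[of a e "c \<^bold>\<or> c'" "d \<^bold>\<and> d'" p] 1 2 dd cc by simp
  qed
qed

lemma germ_eqI:
  assumes "p \<in> points A" "(a, b) \<in> germ_rel A p"
  shows "germ_rel A p `` {a} = germ_rel A p `` {b}"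
  using equiv_class_eq[OF equiv_germ_rel] assms by blast

text \<open>The coordinates of \<open>\<sigma>\<close> are evaluations. The witnesses are found by reading \<open>(a \<^bold>\<and> d) \<^bold>\<or> c\<close> as
  "\<open>a\<close> restricted to \<open>d\<close> and overridden by \<open>c\<close>": the germ of \<open>x \<^bold>\<or> y\<close> is that of \<open>y\<close> where \<open>y\<close> is
  defined (restrict to \<open>y\<close>), and that of \<open>x\<close> elsewhere (override by \<open>y\<close>).\<close>

lemma evaluation_germ_section:
  assumes p: "p \<in> points A"
  shows "evaluation A (\<lambda>a. if p \<in> basic_open A a then Some (germ_section A a p) else None)"
proof -
  let ?G = "\<lambda>a. germ_rel A p `` {a}"
  have e: "(if p \<in> basic_open A a then Some (germ_section A a p) else None) =
    (if p (Dclass A a) then Some (p, ?G a) else None)" for a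
    using p by (simp add: basic_open_def germ_section_def)
  have meet: "?G (x \<^bold>\<and> y) = ?G x"
    if xy: "x \<in> carrier A" "y \<in> carrier A" "p (Dclass A x)" "p (Dclass A y)" for x y
    using xy germ_relI[of "x \<^bold>\<and> y" x "\<^bold>0" y p] meet_closed zero_closed point_zero[OF p]
      meet_assoc meet_idem point_meet[OF p]
    by (intro germ_eqI[OF p]) simp
  have join1: "?G (x \<^bold>\<or> y) = ?G y"
    if xy: "x \<in> carrier A" "y \<in> carrier A" "p (Dclass A y)" for x y
    using xy germ_relI[of "x \<^bold>\<or> y" y "\<^bold>0" y p] join_closed zero_closed point_zero[OF p]
      absorb4 meet_idem point_join[OF p]
    by (intro germ_eqI[OF p]) simp
  have join2: "?G (x \<^bold>\<or> y) = ?G x"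
    if xy: "x \<in> carrier A" "y \<in> carrier A" "p (Dclass A x)" "\<not> p (Dclass A y)" for x y
  proof -
    have "((x \<^bold>\<or> y) \<^bold>\<and> (x \<^bold>\<or> y)) \<^bold>\<or> y = (x \<^bold>\<and> (x \<^bold>\<or> y)) \<^bold>\<or> y"
      using xy join_closed meet_idem absorb1 join_assoc join_idem by simp
    then show ?thesis
      using xy germ_relI[of "x \<^bold>\<or> y" x y "x \<^bold>\<or> y" p] join_closed point_join[OF p]
      by (intro germ_eqI[OF p]) simp
  qed
  have "\<exists>x\<in>X. p (Dclass A x)"
    if "commuting_subset A X" "is_lub (natural_order A) s X" "p (Dclass A s)" for X s
    using point_lub[OF p that(1,2)] that(3) by simp
  then show ?thesis
    unfolding e evaluation_def
    using point_zero[OF p] point_meet[OF p] point_join[OF p] meet join1 join2 by auto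
qed

end

section \<open>Algebras determined by their evaluations\<close>

text \<open>Equational laws, order, suprema and morphisms of such an algebra are all checked one coordinate at a
  time. The last assumption, that commuting elements can be patched together, is what makes it join
  complete.\<close>

locale pointwise_algebra =
  fixes B :: "'b skew_algebra" (structure) and I :: "'i set" and val :: "'i \<Rightarrow> 'b \<Rightarrow> 'g option"
  assumes meet_in: "\<lbrakk>x \<in> carrier B; y \<in> carrier B\<rbrakk> \<Longrightarrow> x \<^bold>\<and> y \<in> carrier B"
    and join_in: "\<lbrakk>x \<in> carrier B; y \<in> carrier B\<rbrakk> \<Longrightarrow> x \<^bold>\<or> y \<in> carrier B"
    and zero_in: "\<^bold>0 \<in> carrier B"
    and val_meet: "\<lbrakk>x \<in> carrier B; y \<in> carrier B; i \<in> I\<rbrakk>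
      \<Longrightarrow> val i (x \<^bold>\<and> y) = (if val i y = None then None else val i x)"
    and val_join: "\<lbrakk>x \<in> carrier B; y \<in> carrier B; i \<in> I\<rbrakk>
      \<Longrightarrow> val i (x \<^bold>\<or> y) = (if val i y = None then val i x else val i y)"
    and val_zero: "i \<in> I \<Longrightarrow> val i \<^bold>0 = None"
    and separated: "\<lbrakk>x \<in> carrier B; y \<in> carrier B; \<And>i. i \<in> I \<Longrightarrow> val i x = val i y\<rbrakk> \<Longrightarrow> x = y"
    and amalgam: "commuting_subset B X \<Longrightarrow> \<exists>s\<in>carrier B. \<forall>i\<in>I.
      (\<forall>x\<in>X. val i x \<noteq> None \<longrightarrow> val i s = val i x) \<and> (val i s \<noteq> None \<longrightarrow> (\<exists>x\<in>X. val i x \<noteq> None))"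
begin

lemmas in_carrier = meet_in join_in zero_in
lemmas val_simps = val_meet val_join val_zero

sublocale left_handed_skew_lattice B
proof unfold_locales
  show "left_handed B"
    unfolding left_handed_def by (auto intro!: separated simp: in_carrier val_simps)
qed (auto intro!: separated simp: in_carrier val_simps)

sublocale skew_lattice_with_zero B
  by unfold_locales (auto intro!: separated simp: in_carrier val_simps)

lemma le_iff_val:
  assumes "x \<in> carrier B" "y \<in> carrier B"
  shows "x \<^bold>\<and> y = x \<and> y \<^bold>\<and> x = x \<longleftrightarrow> (\<forall>i\<in>I. val i x \<noteq> None \<longrightarrow> val i y = val i x)" (is "?L \<longleftrightarrow> ?R")
proof
  assume L: ?L
  show ?R
  proof (intro ballI impI)
    fix i assume i: "i \<in> I" "val i x \<noteq> None"
    have "val i (y \<^bold>\<and> x) = val i x" using L by simp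
    then show "val i y = val i x" using val_meet[OF assms(2,1) i(1)] i(2) by simp
  qed
next
  assume R: ?R
  show ?L
  proof
    show "x \<^bold>\<and> y = x" "y \<^bold>\<and> x = x"
      using assms R by (auto intro!: separated simp: in_carrier val_simps)
  qed
qed

definition pointwise_sup :: "'b \<Rightarrow> 'b set \<Rightarrow> bool" where
  "pointwise_sup s X \<longleftrightarrow> s \<in> carrier B \<and> (\<forall>i\<in>I.
     (\<forall>x\<in>X. val i x \<noteq> None \<longrightarrow> val i s = val i x) \<and> (val i s \<noteq> None \<longrightarrow> (\<exists>x\<in>X. val i x \<noteq> None)))"

lemma is_lub_if_pointwise_sup:
  assumes X: "X \<subseteq> carrier B" and s: "pointwise_sup s X"
  shows "is_lub (natural_order B) s X"
proof -
  have sc: "s \<in> carrier B" using s by (simp add: pointwise_sup_def)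
  have "x \<^bold>\<and> s = x \<and> s \<^bold>\<and> x = x" if "x \<in> X" for x
  proof -
    have "x \<in> carrier B" using that X by blast
    then show ?thesis unfolding le_iff_val[OF \<open>x \<in> carrier B\<close> sc]
      using s that by (simp add: pointwise_sup_def)
  qed
  moreover have "s \<^bold>\<and> u = s \<and> u \<^bold>\<and> s = s"
    if u: "u \<in> carrier B" "\<forall>x\<in>X. x \<^bold>\<and> u = x \<and> u \<^bold>\<and> x = x" for u
    unfolding le_iff_val[OF sc u(1)]
  proof (intro ballI impI)
    fix i assume i: "i \<in> I" "val i s \<noteq> None"
    then obtain x where x: "x \<in> X" "val i x \<noteq> None" using s by (auto simp: pointwise_sup_def)
    then have "val i s = val i x" using s i by (simp add: pointwise_sup_def)
    moreover have "val i u = val i x"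
      using u x i le_iff_val[of x u] X by blast
    ultimately show "val i u = val i s" by simp
  qed
  ultimately show ?thesis using sc by (simp add: is_lub_natural_order[OF X])
qed

lemma pointwise_sup_exists: "commuting_subset B X \<Longrightarrow> \<exists>s. pointwise_sup s X"
  using amalgam unfolding pointwise_sup_def by blast

lemma is_lub_iff_pointwise_sup:
  assumes X: "commuting_subset B X"
  shows "is_lub (natural_order B) s X \<longleftrightarrow> pointwise_sup s X"
proof
  have X': "X \<subseteq> carrier B" using X by (simp add: commuting_subset_def)
  assume s: "is_lub (natural_order B) s X"
  obtain t where t: "pointwise_sup t X" using pointwise_sup_exists[OF X] by blast
  have "is_lub (natural_order B) t X" using is_lub_if_pointwise_sup[OF X' t] .
  then have "s \<^bold>\<and> t = s" "s \<^bold>\<and> t = t"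
    using s unfolding is_lub_natural_order[OF X'] by blast+
  then show "pointwise_sup s X" using t by simp
next
  assume "pointwise_sup s X"
  then show "is_lub (natural_order B) s X"
    using is_lub_if_pointwise_sup X by (simp add: commuting_subset_def)
qed

lemma noncommutative_frame: "noncommutative_frame B"
proof unfold_locales
  show "strongly_distributive B"
    unfolding strongly_distributive_def by (auto intro!: separated simp: in_carrier val_simps)
  show "join_complete B"
    unfolding join_complete_def using pointwise_sup_exists is_lub_iff_pointwise_sup by blast
  fix X s y
  assume X: "commuting_subset B X" and s: "is_lub (natural_order B) s X" and y: "y \<in> carrier B"
  have X': "X \<subseteq> carrier B" using X by (simp add: commuting_subset_def)
  then have Xc: "x \<in> carrier B" if "x \<in> X" for x using that by blast
  have s': "pointwise_sup s X" using s is_lub_iff_pointwise_sup[OF X] by simp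
  then have sc: "s \<in> carrier B" by (simp add: pointwise_sup_def)
  have vs: "val i s = val i x" if "x \<in> X" "val i x \<noteq> None" "i \<in> I" for i x
    using s' that by (simp add: pointwise_sup_def)
  have ex: "\<exists>x\<in>X. val i x \<noteq> None" if "val i s \<noteq> None" "i \<in> I" for i
    using s' that unfolding pointwise_sup_def by blast
  show "is_lub (natural_order B) (s \<^bold>\<and> y) ((\<lambda>x. x \<^bold>\<and> y) ` X)"
  proof (rule is_lub_if_pointwise_sup)
    show "pointwise_sup (s \<^bold>\<and> y) ((\<lambda>x. x \<^bold>\<and> y) ` X)"
      unfolding pointwise_sup_def
    proof (intro conjI ballI impI)
      fix i z assume i: "i \<in> I" and "z \<in> (\<lambda>x. x \<^bold>\<and> y) ` X" "val i z \<noteq> None"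
      then show "val i (s \<^bold>\<and> y) = val i z"
        using vs[OF _ _ i] val_meet[OF Xc y i] val_meet[OF sc y i] by (auto split: if_splits)
    next
      fix i assume i: "i \<in> I" and "val i (s \<^bold>\<and> y) \<noteq> None"
      then have "val i s \<noteq> None" "val i y \<noteq> None" using val_meet[OF sc y i] by (auto split: if_splits)
      then show "\<exists>z\<in>(\<lambda>x. x \<^bold>\<and> y) ` X. val i z \<noteq> None"
        using ex[OF _ i] val_meet[OF Xc y i] by auto
    qed (simp add: sc y in_carrier)
  qed (use Xc y in_carrier in auto)
  show "is_lub (natural_order B) (y \<^bold>\<and> s) ((\<lambda>x. y \<^bold>\<and> x) ` X)"
  proof (rule is_lub_if_pointwise_sup)
    show "pointwise_sup (y \<^bold>\<and> s) ((\<lambda>x. y \<^bold>\<and> x) ` X)"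
      unfolding pointwise_sup_def
    proof (intro conjI ballI impI)
      fix i z assume i: "i \<in> I" and z: "z \<in> (\<lambda>x. y \<^bold>\<and> x) ` X" "val i z \<noteq> None"
      then obtain x where x: "x \<in> X" "z = y \<^bold>\<and> x" by blast
      then have "val i x \<noteq> None" using z(2) val_meet[OF y Xc[OF x(1)] i] by (auto split: if_splits)
      then show "val i (y \<^bold>\<and> s) = val i z"
        using vs[OF x(1) _ i] val_meet[OF y Xc[OF x(1)] i] val_meet[OF y sc i] x(2) by simp
    next
      fix i assume i: "i \<in> I" and "val i (y \<^bold>\<and> s) \<noteq> None"
      then have "val i s \<noteq> None" "val i y \<noteq> None" using val_meet[OF y sc i] by (auto split: if_splits)
      then show "\<exists>z\<in>(\<lambda>x. y \<^bold>\<and> x) ` X. val i z \<noteq> None"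
        using ex[OF _ i] val_meet[OF y Xc i] by auto
    qed (simp add: sc y in_carrier)
  qed (use Xc y in_carrier in auto)
qed

lemma evaluation_val:
  assumes i: "i \<in> I"
  shows "evaluation B (val i)"
proof -
  have "\<exists>x\<in>X. val i x \<noteq> None"
    if "commuting_subset B X" "is_lub (natural_order B) s X" "val i s \<noteq> None" for X s
    using that is_lub_iff_pointwise_sup[OF that(1)] i unfolding pointwise_sup_def by blast
  then show ?thesis unfolding evaluation_def using i val_simps by auto
qed

lemma total_in_maximal_Dclass:
  assumes m: "m \<in> carrier B" "\<And>i. i \<in> I \<Longrightarrow> val i m \<noteq> None"
  shows "m \<in> maximal_Dclass B"
proof -
  have "x \<^bold>\<and> m = x" if "x \<in> carrier B" for x
    using that m(1) by (intro separated) (simp_all add: in_carrier val_simps m(2))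
  then show ?thesis using m(1) by (simp add: maximal_Dclass_iff)
qed

text \<open>A map is a morphism as soon as each of its coordinates is an evaluation and it sends maximal elements
  to everywhere defined ones.\<close>

lemma ncframe_homI:
  assumes A: "skew_lattice_with_zero A"
    and f: "\<And>x. x \<in> carrier A \<Longrightarrow> f x \<in> carrier B"
    and e: "\<And>i. i \<in> I \<Longrightarrow> evaluation A (\<lambda>x. val i (f x))"
    and m: "\<And>m i. \<lbrakk>m \<in> maximal_Dclass A; i \<in> I\<rbrakk> \<Longrightarrow> val i (f m) \<noteq> None"
  shows "ncframe_hom A B f"
proof -
  interpret A: skew_lattice_with_zero A by fact
  have "f (x \<^bold>\<and>\<^bsub>A\<^esub> y) = f x \<^bold>\<and> f y" if "x \<in> carrier A" "y \<in> carrier A" for x y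
    using that f A.meet_closed evaluation_meet[OF e that]
    by (intro separated) (simp_all add: in_carrier val_simps)
  moreover have "f (x \<^bold>\<or>\<^bsub>A\<^esub> y) = f x \<^bold>\<or> f y" if "x \<in> carrier A" "y \<in> carrier A" for x y
    using that f A.join_closed evaluation_join[OF e that]
    by (intro separated) (simp_all add: in_carrier val_simps)
  moreover have "f \<^bold>0\<^bsub>A\<^esub> = \<^bold>0"
    using f A.zero_closed evaluation_zero[OF e]
    by (intro separated) (simp_all add: in_carrier val_simps)
  moreover have "is_lub (natural_order B) (f s) (f ` X)"
    if X: "commuting_subset A X" and s: "is_lub (natural_order A) s X" for X s
  proof (rule is_lub_if_pointwise_sup)
    have X': "X \<subseteq> carrier A" using X by (simp add: commuting_subset_def)
    then show "f ` X \<subseteq> carrier B" using f by blast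
    have "s \<in> carrier A" using s unfolding is_lub_natural_order[OF X'] by blast
    then show "pointwise_sup (f s) (f ` X)"
      unfolding pointwise_sup_def
      using f evaluation_lub_eq[OF e X s] evaluation_lub_support[OF e X s] by blast
  qed
  moreover have "f ` maximal_Dclass A \<subseteq> maximal_Dclass B"
  proof (rule image_subsetI)
    fix x assume x: "x \<in> maximal_Dclass A"
    then have "x \<in> carrier A" by (simp add: maximal_Dclass_def)
    then show "f x \<in> maximal_Dclass B" using total_in_maximal_Dclass f m[OF x] by blast
  qed
  ultimately show ?thesis unfolding ncframe_hom_def using f by blast
qed

end

lemma pointwise_partial_functions: "pointwise_algebra (partial_functions R S) R (\<lambda>r f. f r)"
proof
  let ?B = "partial_functions R S"
  show "x = y" if "x \<in> carrier ?B" "y \<in> carrier ?B" "\<And>r. r \<in> R \<Longrightarrow> x r = y r" for x y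
  proof
    fix r show "x r = y r"
    proof (cases "r \<in> R")
      case False
      then have "r \<notin> dom x" "r \<notin> dom y" using that(1,2) by (auto simp: partial_functions_def)
      then show ?thesis by (simp add: domIff)
    qed (simp add: that(3))
  qed
  fix X assume X: "commuting_subset ?B X"
  have agree: "f r = g r" if "f \<in> X" "g \<in> X" "f r \<noteq> None" "g r \<noteq> None" for f g r
  proof -
    have "f \<^bold>\<and>\<^bsub>?B\<^esub> g = g \<^bold>\<and>\<^bsub>?B\<^esub> f" using X that(1,2) unfolding commuting_subset_def by blast
    then have "(f |` (dom f \<inter> dom g)) r = (g |` (dom g \<inter> dom f)) r"
      by (simp add: partial_functions_def)
    then show ?thesis using that(3,4) by (auto simp: restrict_map_def dom_def)
  qed
  define s where "s r = (if \<exists>f\<in>X. f r \<noteq> None then (SOME f. f \<in> X \<and> f r \<noteq> None) r else None)" for r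
  have s1: "s r = f r" if f: "f \<in> X" "f r \<noteq> None" for f r
  proof -
    have "\<exists>f. f \<in> X \<and> f r \<noteq> None" using f by blast
    then have "(SOME f. f \<in> X \<and> f r \<noteq> None) \<in> X \<and> (SOME f. f \<in> X \<and> f r \<noteq> None) r \<noteq> None"
      by (rule someI_ex)
    then have "(SOME f. f \<in> X \<and> f r \<noteq> None) r = f r" using agree f by blast
    moreover have "\<exists>f\<in>X. f r \<noteq> None" using f by blast
    ultimately show ?thesis by (simp add: s_def)
  qed
  have s2: "\<exists>f\<in>X. f r \<noteq> None" if "s r \<noteq> None" for r using that by (metis s_def)
  have "dom s \<subseteq> R \<and> ran s \<subseteq> S"
  proof -
    have Xc: "dom f \<subseteq> R" "ran f \<subseteq> S" if "f \<in> X" for f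
      using X that by (auto simp: commuting_subset_def partial_functions_def)
    have "r \<in> R \<and> v \<in> S" if v: "s r = Some v" for r v
    proof -
      obtain f where f: "f \<in> X" "f r \<noteq> None" using s2[of r] v by auto
      then have "f r = Some v" using s1[OF f] v by simp
      then show ?thesis using Xc[OF f(1)] by (auto intro: ranI)
    qed
    then show ?thesis by (auto simp: ran_def)
  qed
  then have "s \<in> carrier ?B" by (simp add: partial_functions_def)
  then show "\<exists>s\<in>carrier ?B. \<forall>r\<in>R. (\<forall>f\<in>X. f r \<noteq> None \<longrightarrow> s r = f r) \<and> (s r \<noteq> None \<longrightarrow> (\<exists>f\<in>X. f r \<noteq> None))"
  proof (rule bexI[rotated], intro ballI conjI impI)
    fix r f assume "f \<in> X" "f r \<noteq> None"
    then show "s r = f r" by (rule s1)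
  next
    fix r assume "s r \<noteq> None"
    then show "\<exists>f\<in>X. f r \<noteq> None" by (rule s2)
  qed
next
  let ?B = "partial_functions R S"
  fix x y assume xy: "x \<in> carrier ?B" "y \<in> carrier ?B"
  have "dom (x |` (dom x \<inter> dom y)) \<subseteq> dom x" "ran (x |` (dom x \<inter> dom y)) \<subseteq> ran x"
    by (auto simp: ran_def restrict_map_def split: if_splits)
  then show "x \<^bold>\<and>\<^bsub>?B\<^esub> y \<in> carrier ?B" using xy unfolding partial_functions_def by simp blast
  have "dom (x ++ y) \<subseteq> dom x \<union> dom y" "ran (x ++ y) \<subseteq> ran x \<union> ran y"
    by (auto simp: ran_def map_add_Some_iff)
  then show "x \<^bold>\<or>\<^bsub>?B\<^esub> y \<in> carrier ?B" using xy unfolding partial_functions_def by simp blast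
  fix r
  show "(x \<^bold>\<and>\<^bsub>?B\<^esub> y) r = (if y r = None then None else x r)"
    by (cases "x r") (auto simp: partial_functions_def restrict_map_def)
  show "(x \<^bold>\<or>\<^bsub>?B\<^esub> y) r = (if y r = None then x r else y r)"
    by (simp add: partial_functions_def map_add_def split: option.split)
qed (simp_all add: partial_functions_def)

section \<open>Algebras of sections\<close>

lemma openin_front_Diff:
  assumes "openin Y U" "openin Y V"
  shows "openin (front Y) (U - V)"
proof -
  have "U - V = U \<inter> (topspace Y - V)" using openin_subset[OF assms(1)] by blast
  then have "locally_closed_in Y (U - V)"
    unfolding locally_closed_in_def using assms by blast
  then show ?thesis unfolding openin_front by (rule arbitrary_union_of_inc)
qed

lemma openin_front_openin: "openin Y U \<Longrightarrow> openin (front Y) U"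
  using openin_front_Diff[of Y U "{}"] by simp

lemma (in sheaf) section_eqI:
  assumes U: "\<And>W. W \<in> \<U> \<Longrightarrow> openin T W" "\<Union>\<U> = U" and s: "s \<in> sections E U" "t \<in> sections E U"
    and eq: "\<And>W. W \<in> \<U> \<Longrightarrow> res E U W s = res E U W t"
  shows "s = t"
proof -
  have oU: "openin T U" using U by (metis openin_Union)
  have sub: "W \<subseteq> U" if "W \<in> \<U>" for W using that U(2) by blast
  have "\<exists>!r. r \<in> sections E (\<Union>\<U>) \<and> (\<forall>W\<in>\<U>. res E (\<Union>\<U>) W r = res E U W s)"
  proof (rule glue[where t = "\<lambda>W. res E U W s"])
    fix V W assume VW: "V \<in> \<U>" "W \<in> \<U>"
    then have "openin T (V \<inter> W)" using U(1) by blast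
    then show "res E V (V \<inter> W) (res E U V s) = res E W (V \<inter> W) (res E U W s)"
      using VW U(1) oU sub s(1) res_comp by simp
  next
    fix W assume W: "W \<in> \<U>"
    show "openin T W" by (rule U(1)[OF W])
    show "res E U W s \<in> sections E W" by (rule res_closed[OF oU U(1)[OF W] sub[OF W] s(1)])
  qed
  then have "\<exists>!r. r \<in> sections E U \<and> (\<forall>W\<in>\<U>. res E U W r = res E U W s)"
    by (simp only: U(2))
  moreover have "\<forall>W\<in>\<U>. res E U W t = res E U W s" using eq by simp
  ultimately show ?thesis using s by blast
qed

locale front_sheaf = sheaf "front Y" E for Y :: "'y topology" and E :: "('y, 's) presheaf"
begin

lemmas front_open = openin_front_openin[of Y] openin_front_Diff[of Y]

text \<open>Gluing applies because \<open>U - V\<close> and \<open>V\<close> form a disjoint front-open cover of \<open>U \<union> V\<close>. If \<open>V\<close> is empty the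
  two members of the cover may coincide, so this case is separate.\<close>

lemma section_of_join:
  assumes UV: "openin Y U" "openin Y V" and st: "s \<in> sections E U" "t \<in> sections E V"
  shows "\<exists>!r. r \<in> sections E (U \<union> V) \<and>
        res E (U \<union> V) (U - V) r = res E U (U - V) s \<and> res E (U \<union> V) V r = t"
proof -
  have sub: "U - V \<subseteq> U" by blast
  have sd: "res E U (U - V) s \<in> sections E (U - V)"
    using res_closed[OF _ _ sub st(1)] UV front_open by simp
  have empty: "x = y" if "x \<in> sections E {}" "y \<in> sections E {}" for x y
    using section_eqI[of "{}" "{}" x y] that by simp
  show ?thesis
  proof (cases "V = {}")
    case True
    have "res E U U x = x" if "x \<in> sections E U" for x
      using res_id that UV front_open by simp
    moreover have "res E U {} x \<in> sections E {}" if "x \<in> sections E U" for x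
      using res_closed[of U "{}"] that UV front_open by simp
    ultimately show ?thesis using True st empty by auto
  next
    case False
    define tt where "tt W = (if W = V then t else res E U (U - V) s)" for W
    have ne: "U - V \<noteq> V" using False by blast
    have "\<exists>!r. r \<in> sections E (\<Union>{U - V, V}) \<and> (\<forall>W\<in>{U - V, V}. res E (\<Union>{U - V, V}) W r = tt W)"
    proof (rule glue)
      fix W assume W: "W \<in> {U - V, V}"
      show "openin (front Y) W" using W UV front_open by blast
      show "tt W \<in> sections E W" using W sd st by (auto simp: tt_def)
    next
      fix W W' assume W: "W \<in> {U - V, V}" "W' \<in> {U - V, V}"
      show "res E W (W \<inter> W') (tt W) = res E W' (W \<inter> W') (tt W')"
      proof (cases "W = W'")
        case False
        have "res E W {} (tt W) \<in> sections E {}" if "W \<in> {U - V, V}" for W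
          using that sd st UV front_open by (auto simp: tt_def intro!: res_closed)
        moreover have "W \<inter> W' = {}" using W False by blast
        ultimately show ?thesis using W empty by metis
      qed simp
    qed
    moreover have "\<Union>{U - V, V} = U \<union> V" by blast
    moreover have "tt (U - V) = res E U (U - V) s" "tt V = t" using ne by (simp_all add: tt_def)
    ultimately show ?thesis by (simp only: ball_simps simp_thms)
  qed
qed

lemma H_meet_eq: "(U, s) \<^bold>\<and>\<^bsub>H Y E\<^esub> (V, t) = (U \<inter> V, res E U (U \<inter> V) s)"
  by (simp add: H_def H_meet_def)

lemma carrier_H: "(U, s) \<in> carrier (H Y E) \<longleftrightarrow> openin Y U \<and> s \<in> sections E U"
  by (simp add: H_def)

lemma H_join_cases:
  assumes "openin Y U" "openin Y V" "s \<in> sections E U" "t \<in> sections E V"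
  obtains r where "(U, s) \<^bold>\<or>\<^bsub>H Y E\<^esub> (V, t) = (U \<union> V, r)" "r \<in> sections E (U \<union> V)"
    "res E (U \<union> V) (U - V) r = res E U (U - V) s" "res E (U \<union> V) V r = t"
proof -
  let ?P = "\<lambda>r. r \<in> sections E (U \<union> V) \<and>
        res E (U \<union> V) (U - V) r = res E U (U - V) s \<and> res E (U \<union> V) V r = t"
  have "?P (THE r. ?P r)" by (rule theI') (rule section_of_join[OF assms])
  moreover have "(U, s) \<^bold>\<or>\<^bsub>H Y E\<^esub> (V, t) = (U \<union> V, THE r. ?P r)"
    by (simp add: H_def H_join_def)
  ultimately show ?thesis using that by blast
qed

lemma H_zero_cases:
  obtains r where "\<^bold>0\<^bsub>H Y E\<^esub> = ({}, r)" "r \<in> sections E {}"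
proof -
  have "\<exists>!r. r \<in> sections E {}" using glue[of "{}"] by simp
  then have "(THE r. r \<in> sections E {}) \<in> sections E {}" by (rule theI')
  then show ?thesis using that by (simp add: H_def)
qed

definition same_germ :: "'y \<Rightarrow> 'y set \<times> 's \<Rightarrow> 'y set \<times> 's \<Rightarrow> bool" where
  "same_germ y = (\<lambda>(U, s) (V, t).
     \<exists>W. openin (front Y) W \<and> y \<in> W \<and> W \<subseteq> U \<inter> V \<and> res E U W s = res E V W t)"

text \<open>Whether an element has the germ of a fixed section at \<open>y\<close> depends only on its restriction to a
  front-neighbourhood of \<open>y\<close>.\<close>

lemma same_germ_local:
  assumes V: "openin Y V" "r \<in> sections E V" and V': "openin Y V'" "r' \<in> sections E V'"
    and U: "openin Y U" "s \<in> sections E U"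
    and N: "openin (front Y) N" "y \<in> N" "N \<subseteq> V" "N \<subseteq> V'" "res E V N r = res E V' N r'"
  shows "same_germ y (U, s) (V, r) \<longleftrightarrow> same_germ y (U, s) (V', r')"
proof -
  have *: "same_germ y (U, s) (V', r')"
    if V: "openin Y V" "r \<in> sections E V" and V': "openin Y V'" "r' \<in> sections E V'"
      and N: "N \<subseteq> V" "N \<subseteq> V'" "res E V N r = res E V' N r'"
      and g: "same_germ y (U, s) (V, r)" for V V' r r'
  proof -
    obtain W where W: "openin (front Y) W" "y \<in> W" "W \<subseteq> U" "W \<subseteq> V" "res E U W s = res E V W r"
      using g by (auto simp: same_germ_def)
    have o: "openin (front Y) (W \<inter> N)" using W N(1) assms(7) by blast
    have "res E U (W \<inter> N) s = res E W (W \<inter> N) (res E U W s)"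
      using res_comp[of U W "W \<inter> N" s] U W o front_open by simp
    also have "\<dots> = res E V (W \<inter> N) r"
      using res_comp[of V W "W \<inter> N" r] V W o front_open by simp
    also have "\<dots> = res E N (W \<inter> N) (res E V N r)"
      using res_comp[of V N "W \<inter> N" r] V N assms(7) o front_open by simp
    also have "\<dots> = res E V' (W \<inter> N) r'"
      using res_comp[of V' N "W \<inter> N" r'] V' N assms(7) o front_open by simp
    finally show ?thesis
      unfolding same_germ_def using o W N assms(8) by blast
  qed
  show ?thesis using *[OF V V'] *[OF V' V] N by metis
qed

text \<open>The restriction of \<open>r\<close> to the union of the domains is still an upper bound, so the supremum cannot be
  defined anywhere else.\<close>

lemma H_lub_support:
  assumes X: "X \<subseteq> carrier (H Y E)" and lub: "is_lub (natural_order (H Y E)) (V, r) X"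
  shows "V \<subseteq> \<Union>(fst ` X)"
proof -
  let ?V = "\<Union>(fst ` X)"
  have V: "openin Y V" "r \<in> sections E V"
    using lub by (simp_all add: is_lub_natural_order[OF X] carrier_H)
  have Xo: "openin Y U" "s \<in> sections E U" "U \<subseteq> V" "res E V U r = s" if "(U, s) \<in> X" for U s
  proof -
    show "openin Y U" "s \<in> sections E U" using that X carrier_H by blast+
    have "(U, s) \<^bold>\<and>\<^bsub>H Y E\<^esub> (V, r) = (U, s)" "(V, r) \<^bold>\<and>\<^bsub>H Y E\<^esub> (U, s) = (U, s)"
      using lub that unfolding is_lub_natural_order[OF X] by blast+
    then show "U \<subseteq> V" "res E V U r = s" by (auto simp: H_meet_eq Int_absorb1)
  qed
  have Vo: "openin Y ?V" using Xo(1) by auto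
  have sub: "?V \<subseteq> V" using Xo(3) by (force simp: subset_iff)
  have r: "res E V ?V r \<in> sections E ?V"
    using res_closed[OF _ _ sub V(2)] V Vo front_open by simp
  have "x \<^bold>\<and>\<^bsub>H Y E\<^esub> (?V, res E V ?V r) = x \<and> (?V, res E V ?V r) \<^bold>\<and>\<^bsub>H Y E\<^esub> x = x" if x: "x \<in> X" for x
  proof -
    obtain U s where Us: "x = (U, s)" by (cases x)
    note U = Xo[OF x[unfolded Us]]
    have UV: "U \<subseteq> ?V" using x Us by force
    have "res E U U s = s" using res_id U front_open by simp
    moreover have "res E ?V U (res E V ?V r) = s"
      using res_comp[OF _ _ _ UV sub V(2)] V Vo U front_open by simp
    moreover have "U \<inter> ?V = U" "?V \<inter> U = U" using UV by blast+
    ultimately show ?thesis by (simp only: Us H_meet_eq)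
  qed
  moreover have "(?V, res E V ?V r) \<in> carrier (H Y E)" using Vo r carrier_H by blast
  ultimately have "(V, r) \<^bold>\<and>\<^bsub>H Y E\<^esub> (?V, res E V ?V r) = (V, r)"
    using lub unfolding is_lub_natural_order[OF X] by blast
  then show ?thesis by (auto simp: H_meet_eq)
qed

text \<open>Instead of the germ at \<open>y\<close> itself, the evaluation records whether that germ is the one of a fixed
  section \<open>s\<close>. The germ of a join at \<open>y\<close> is that of the second argument on its domain \<open>V'\<close>, and that of
  the first on the front-open set \<open>V - V'\<close>; this is where the front topology enters.\<close>

lemma evaluation_same_germ:
  assumes U: "openin Y U" "s \<in> sections E U"
  shows "evaluation (H Y E) (\<lambda>x. if y \<in> fst x then Some (same_germ y (U, s) x) else None)"
    (is "evaluation _ ?e")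
proof (rule evaluationI)
  fix x x' assume x: "x \<in> carrier (H Y E)" "x' \<in> carrier (H Y E)"
  obtain V r where x1: "x = (V, r)" by (cases x)
  obtain V' r' where x2: "x' = (V', r')" by (cases x')
  note eq = x1 x2
  have V: "openin Y V" "r \<in> sections E V" "openin Y V'" "r' \<in> sections E V'"
    using x by (simp_all add: eq carrier_H)
  show "?e (x \<^bold>\<and>\<^bsub>H Y E\<^esub> x') = (if ?e x' = None then None else ?e x)"
  proof -
    have o: "openin Y (V \<inter> V')" using V by blast
    have c: "res E V (V \<inter> V') r \<in> sections E (V \<inter> V')"
      using res_closed[of V "V \<inter> V'" r] V o front_open by simp
    have "res E (V \<inter> V') (V \<inter> V') (res E V (V \<inter> V') r) = res E V (V \<inter> V') r"
      using res_id c o front_open by simp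
    then have "same_germ y (U, s) (V \<inter> V', res E V (V \<inter> V') r) \<longleftrightarrow> same_germ y (U, s) (V, r)"
      if "y \<in> V \<inter> V'"
      using that same_germ_local[OF o c V(1,2) U, of "V \<inter> V'" y] o front_open by simp
    then show ?thesis by (auto simp: H_meet_eq eq)
  qed
  show "?e (x \<^bold>\<or>\<^bsub>H Y E\<^esub> x') = (if ?e x' = None then ?e x else ?e x')"
  proof -
    obtain q where q: "(V, r) \<^bold>\<or>\<^bsub>H Y E\<^esub> (V', r') = (V \<union> V', q)" "q \<in> sections E (V \<union> V')"
      "res E (V \<union> V') (V - V') q = res E V (V - V') r" "res E (V \<union> V') V' q = r'"
      by (rule H_join_cases[OF V(1,3,2,4)])
    have o: "openin Y (V \<union> V')" using V by blast
    have 1: "same_germ y (U, s) (V \<union> V', q) \<longleftrightarrow> same_germ y (U, s) (V', r')" if "y \<in> V'"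
      using that same_germ_local[OF o q(2) V(3,4) U, of V' y] q(4) res_id V front_open by simp
    have 2: "same_germ y (U, s) (V \<union> V', q) \<longleftrightarrow> same_germ y (U, s) (V, r)" if "y \<in> V - V'"
      using that same_germ_local[OF o q(2) V(1,2) U, of "V - V'" y] q(3) V front_open by blast
    show ?thesis using 1 2 by (auto simp: eq q(1))
  qed
next
  show "?e \<^bold>0\<^bsub>H Y E\<^esub> = None" by (rule H_zero_cases) simp
next
  fix X x
  assume X: "commuting_subset (H Y E) X" and lub: "is_lub (natural_order (H Y E)) x X"
    and "?e x \<noteq> None"
  have "fst x \<subseteq> \<Union>(fst ` X)"
    using H_lub_support[of X "fst x" "snd x"] X lub by (simp add: commuting_subset_def)
  then show "\<exists>x\<in>X. ?e x \<noteq> None" using \<open>?e x \<noteq> None\<close> by (auto split: if_splits)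
qed

lemma separated_by_germ:
  assumes U: "openin Y U" and st: "s \<in> sections E U" "t \<in> sections E U" "s \<noteq> t"
  shows "\<exists>y\<in>U. \<not> same_germ y (U, s) (U, t)"
proof (rule ccontr)
  assume *: "\<not> ?thesis"
  let ?W = "{W. openin (front Y) W \<and> W \<subseteq> U \<and> res E U W s = res E U W t}"
  have "y \<in> \<Union>?W" if "y \<in> U" for y using * that unfolding same_germ_def by auto
  then have "\<Union>?W = U" by blast
  then have "s = t" using section_eqI[of ?W U s t] st by blast
  then show False using st by simp
qed

end

text \<open>The sheaf of all functions, with values in a fixed set, is a sheaf for every topology. The sections
  \<open>s\<^sub>a\<close> are sections of it, and its algebra \<open>H\<close> consists of the functions with open domain, so that
  suprema and joins can be computed pointwise.\<close>

definition function_sheaf :: "('y, 'y \<Rightarrow> 'c) presheaf" where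
  "function_sheaf = \<lparr>sections = extensional, res = (\<lambda>U V s. restrict s V)\<rparr>"

lemma function_sheaf_simps [simp]:
  "sections function_sheaf U = extensional U" "res function_sheaf U V s = restrict s V"
  by (simp_all add: function_sheaf_def)

lemma sheaf_function_sheaf: "sheaf T function_sheaf"
proof
  fix \<U> :: "'a set set" and t :: "'a set \<Rightarrow> 'a \<Rightarrow> 'b"
  assume ext: "\<And>U. U \<in> \<U> \<Longrightarrow> t U \<in> sections function_sheaf U"
    and comp: "\<And>U V. \<lbrakk>U \<in> \<U>; V \<in> \<U>\<rbrakk>
      \<Longrightarrow> res function_sheaf U (U \<inter> V) (t U) = res function_sheaf V (U \<inter> V) (t V)"
  have agree: "t U p = t V p" if "U \<in> \<U>" "V \<in> \<U>" "p \<in> U" "p \<in> V" for U V p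
    using fun_cong[OF comp[OF that(1,2)], of p] that(3,4) by simp
  define s where "s = (\<lambda>p\<in>\<Union>\<U>. t (SOME U. U \<in> \<U> \<and> p \<in> U) p)"
  have s: "s p = t U p" if "U \<in> \<U>" "p \<in> U" for U p
  proof -
    have "(SOME U. U \<in> \<U> \<and> p \<in> U) \<in> \<U> \<and> p \<in> (SOME U. U \<in> \<U> \<and> p \<in> U)"
      by (rule someI_ex) (use that in blast)
    then have "t (SOME U. U \<in> \<U> \<and> p \<in> U) p = t U p" using agree that by blast
    moreover have "p \<in> \<Union>\<U>" using that by blast
    ultimately show ?thesis by (simp add: s_def)
  qed
  have res_s: "restrict s U = t U" if "U \<in> \<U>" for U
    using s[OF that] ext[OF that] by (intro extensionalityI[of _ U]) simp_all
  have s_ext: "s \<in> extensional (\<Union>\<U>)" by (simp add: s_def)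
  have unique: "s' = s" if s': "s' \<in> extensional (\<Union>\<U>)" "\<forall>U\<in>\<U>. restrict s' U = t U" for s'
  proof (rule extensionalityI[OF s'(1) s_ext])
    fix p assume "p \<in> \<Union>\<U>"
    then obtain U where U: "U \<in> \<U>" "p \<in> U" by blast
    then have "s' p = t U p" using s'(2) by (metis restrict_apply')
    then show "s' p = s p" using s U by simp
  qed
  show "\<exists>!s. s \<in> sections function_sheaf (\<Union>\<U>) \<and>
      (\<forall>U\<in>\<U>. res function_sheaf (\<Union>\<U>) U s = t U)"
  proof (rule ex1I[of _ s])
    show "s \<in> sections function_sheaf (\<Union>\<U>) \<and> (\<forall>U\<in>\<U>. res function_sheaf (\<Union>\<U>) U s = t U)"
      using s_ext res_s by simp
  next
    fix s' assume "s' \<in> sections function_sheaf (\<Union>\<U>) \<and>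
      (\<forall>U\<in>\<U>. res function_sheaf (\<Union>\<U>) U s' = t U)"
    then show "s' = s" by (intro unique) simp_all
  qed
qed (simp_all add: Int_absorb1 extensional_restrict)

lemma pointwise_function_sheaf:
  fixes Y :: "'y topology"
  shows "pointwise_algebra (H Y (function_sheaf :: ('y, 'y \<Rightarrow> 'c) presheaf)) (topspace Y)
     (\<lambda>y x. if y \<in> fst x then Some (snd x y) else None)"
    (is "pointwise_algebra ?B _ ?val")
proof -
  interpret front_sheaf Y "function_sheaf :: ('y, 'y \<Rightarrow> 'c) presheaf"
    by (rule front_sheaf.intro) (rule sheaf_function_sheaf)
  have c: "x \<in> carrier ?B \<longleftrightarrow> openin Y (fst x) \<and> snd x \<in> extensional (fst x)" for x
    using carrier_H[of "fst x" "snd x"] by simp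
  have meet: "x \<^bold>\<and>\<^bsub>?B\<^esub> y = (fst x \<inter> fst y, restrict (snd x) (fst x \<inter> fst y))" for x y
    using H_meet_eq[of "fst x" "snd x" "fst y" "snd y"] by simp
  have join: "\<exists>r. x \<^bold>\<or>\<^bsub>?B\<^esub> y = (fst x \<union> fst y, r) \<and> r \<in> extensional (fst x \<union> fst y) \<and>
      (\<forall>p\<in>fst y. r p = snd y p) \<and> (\<forall>p\<in>fst x - fst y. r p = snd x p)"
    if xy: "x \<in> carrier ?B" "y \<in> carrier ?B" for x y
  proof -
    have o: "openin Y (fst x)" "openin Y (fst y)"
      "snd x \<in> sections function_sheaf (fst x)" "snd y \<in> sections function_sheaf (fst y)"
      using xy by (simp_all add: c)
    obtain r where r: "(fst x, snd x) \<^bold>\<or>\<^bsub>?B\<^esub> (fst y, snd y) = (fst x \<union> fst y, r)"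
      "r \<in> sections function_sheaf (fst x \<union> fst y)"
      "res function_sheaf (fst x \<union> fst y) (fst x - fst y) r =
        res function_sheaf (fst x) (fst x - fst y) (snd x)"
      "res function_sheaf (fst x \<union> fst y) (fst y) r = snd y"
      by (rule H_join_cases[OF o])
    have "r p = snd y p" if "p \<in> fst y" for p
      using fun_cong[OF r(4), of p] that by simp
    moreover have "r p = snd x p" if "p \<in> fst x - fst y" for p
      using fun_cong[OF r(3), of p] that by simp
    moreover have "x \<^bold>\<or>\<^bsub>?B\<^esub> y = (fst x \<union> fst y, r)" "r \<in> extensional (fst x \<union> fst y)"
      using r(1,2) by simp_all
    ultimately show ?thesis by blast
  qed
  obtain z where z0: "\<^bold>0\<^bsub>?B\<^esub> = ({}, z)" "z \<in> sections function_sheaf {}"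
    by (rule H_zero_cases)
  then have z: "\<^bold>0\<^bsub>?B\<^esub> = ({}, z)" "z \<in> extensional {}" by simp_all
  show ?thesis
  proof
    fix x y assume xy: "x \<in> carrier ?B" "y \<in> carrier ?B"
    show "x \<^bold>\<and>\<^bsub>?B\<^esub> y \<in> carrier ?B" using xy by (auto simp: c meet)
    obtain r where r: "x \<^bold>\<or>\<^bsub>?B\<^esub> y = (fst x \<union> fst y, r)" "r \<in> extensional (fst x \<union> fst y)"
      "\<forall>p\<in>fst y. r p = snd y p" "\<forall>p\<in>fst x - fst y. r p = snd x p"
      using join[OF xy] by blast
    show "x \<^bold>\<or>\<^bsub>?B\<^esub> y \<in> carrier ?B" using xy r by (auto simp: c)
    fix p
    show "?val p (x \<^bold>\<and>\<^bsub>?B\<^esub> y) = (if ?val p y = None then None else ?val p x)" by (auto simp: meet)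
    show "?val p (x \<^bold>\<or>\<^bsub>?B\<^esub> y) = (if ?val p y = None then ?val p x else ?val p y)"
      using r by auto
  next
    show "\<^bold>0\<^bsub>?B\<^esub> \<in> carrier ?B" using z by (simp add: c)
    show "?val p \<^bold>0\<^bsub>?B\<^esub> = None" for p using z by simp
  next
    fix x y assume xy: "x \<in> carrier ?B" "y \<in> carrier ?B"
      and eq: "\<And>p. p \<in> topspace Y \<Longrightarrow> ?val p x = ?val p y"
    have sub: "fst x \<subseteq> topspace Y" "fst y \<subseteq> topspace Y" using xy by (auto simp: c openin_subset)
    have "p \<in> fst x \<longleftrightarrow> p \<in> fst y" if "p \<in> topspace Y" for p
      using eq[OF that] by (auto split: if_splits)
    then have f: "fst x = fst y" using sub by blast
    have "snd x p = snd y p" if "p \<in> fst x" for p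
      using eq[of p] that sub f by auto
    then have "snd x = snd y" using xy f by (intro extensionalityI[of _ "fst x"]) (auto simp: c)
    then show "x = y" using f by (simp add: prod_eq_iff)
  next
    fix X assume X: "commuting_subset ?B X"
    have Xc: "x \<in> carrier ?B" if "x \<in> X" for x using X that by (auto simp: commuting_subset_def)
    have agree: "snd x p = snd y p" if "x \<in> X" "y \<in> X" "p \<in> fst x" "p \<in> fst y" for x y p
    proof -
      have "x \<^bold>\<and>\<^bsub>?B\<^esub> y = y \<^bold>\<and>\<^bsub>?B\<^esub> x" using X that(1,2) unfolding commuting_subset_def by blast
      then have eq: "restrict (snd x) (fst x \<inter> fst y) = restrict (snd y) (fst y \<inter> fst x)"
        unfolding meet prod.inject by (rule conjunct2)
      show ?thesis using fun_cong[OF eq, of p] that by simp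
    qed
    define s where "s = (\<lambda>p\<in>\<Union>(fst ` X). snd (SOME x. x \<in> X \<and> p \<in> fst x) p)"
    have s: "s p = snd x p" if "x \<in> X" "p \<in> fst x" for x p
    proof -
      have "(SOME x. x \<in> X \<and> p \<in> fst x) \<in> X \<and> p \<in> fst (SOME x. x \<in> X \<and> p \<in> fst x)"
        by (rule someI_ex) (use that in blast)
      then have "snd (SOME x. x \<in> X \<and> p \<in> fst x) p = snd x p" using agree that by blast
      moreover have "p \<in> \<Union>(fst ` X)" using that by blast
      ultimately show ?thesis by (simp add: s_def)
    qed
    have "openin Y (\<Union>(fst ` X))" using Xc c by auto
    then have "(\<Union>(fst ` X), s) \<in> carrier ?B" by (simp add: c s_def)
    then show "\<exists>z\<in>carrier ?B. \<forall>p\<in>topspace Y.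
        (\<forall>x\<in>X. ?val p x \<noteq> None \<longrightarrow> ?val p z = ?val p x) \<and>
        (?val p z \<noteq> None \<longrightarrow> (\<exists>x\<in>X. ?val p x \<noteq> None))"
      by (rule bexI[rotated]) (auto simp: s)
  qed
qed

section \<open>From embeddings to separating morphisms\<close>

text \<open>Equivalent elements have the same support under an evaluation, so if the values differ then both are
  defined and a two-valued test tells them apart.\<close>

lemma (in left_handed_skew_lattice) hom_to_primitive_if_evaluation_differs:
  assumes e: "evaluation A e" and ab: "(a, b) \<in> greenD A" and ne: "e a \<noteq> e b"
  shows "\<exists>q. ncframe_hom A primitive_skew q \<and> q a = OneA \<and> q b = OneB"
proof -
  have *: "a \<in> carrier A" "b \<in> carrier A" "a \<^bold>\<and> b = a" "b \<^bold>\<and> a = b"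
    using ab by (simp_all add: greenD_iff)
  have "e a = (if e b = None then None else e a)" "e b = (if e a = None then None else e b)"
    using evaluation_meet[OF e *(1,2)] evaluation_meet[OF e *(2,1)] *(3,4) by simp_all
  then obtain u v where uv: "e a = Some u" "e b = Some v"
    using ne by (cases "e a"; cases "e b") auto
  then have "u \<noteq> v" using ne by simp
  then show ?thesis
    by (rule hom_to_primitive_if_evaluation_separates[OF left_handed_skew_lattice_axioms e *(1) uv])
qed

lemma (in left_handed_skew_lattice) hom_to_primitive_if_embeds_in_partial_functions:
  assumes emb: "embeds_in_partial_functions TYPE('r) TYPE('t) A"
    and ab: "(a, b) \<in> greenD A" "a \<noteq> b"
  shows "\<exists>q. ncframe_hom A primitive_skew q \<and> q a = OneA \<and> q b = OneB"
proof -
  obtain R :: "'r set" and S :: "'t set" and f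
    where f: "ncframe_hom A (partial_functions R S) f" "inj_on f (carrier A)"
    using emb unfolding embeds_in_partial_functions_def by blast
  interpret P: pointwise_algebra "partial_functions R S" R "\<lambda>r g. g r"
    by (rule pointwise_partial_functions)
  have c: "a \<in> carrier A" "b \<in> carrier A" using ab by (simp_all add: greenD_iff)
  then have fc: "f a \<in> carrier (partial_functions R S)" "f b \<in> carrier (partial_functions R S)"
    using f(1) by (auto simp: ncframe_hom_def)
  have "f a \<noteq> f b" using f(2) c ab(2) by (simp add: inj_on_eq_iff)
  then obtain r where r: "r \<in> R" "f a r \<noteq> f b r" using P.separated[OF fc] by blast
  have "evaluation A ((\<lambda>g. g r) \<circ> f)" by (rule evaluation_compose[OF f(1) P.evaluation_val[OF r(1)]])
  then show ?thesis
    by (rule hom_to_primitive_if_evaluation_differs[OF _ ab(1)]) (simp add: r(2))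
qed

lemma (in left_handed_skew_lattice) hom_to_primitive_if_embeds_in_spatial:
  assumes emb: "embeds_in_spatial TYPE('b) TYPE('y) TYPE('s) A"
    and ab: "(a, b) \<in> greenD A" "a \<noteq> b"
  shows "\<exists>q. ncframe_hom A primitive_skew q \<and> q a = OneA \<and> q b = OneB"
proof -
  obtain B :: "'b skew_algebra" and f where B: "spatial_ncframe TYPE('y) TYPE('s) B"
    and f: "ncframe_hom A B f" "inj_on f (carrier A)"
    using emb unfolding embeds_in_spatial_def by blast
  obtain Y :: "'y topology" and E :: "('y, 's) presheaf" where sh: "sheaf (front Y) E"
    and iso: "ncframe_iso B (H Y E)"
    using B unfolding spatial_ncframe_def by blast
  obtain h k where h: "ncframe_hom B (H Y E) h" and kh: "\<forall>x\<in>carrier B. k (h x) = x"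
    using iso unfolding ncframe_iso_def by blast
  interpret front_sheaf Y E by (rule front_sheaf.intro) (rule sh)
  have c: "a \<in> carrier A" "b \<in> carrier A" "a \<^bold>\<and> b = a" "b \<^bold>\<and> a = b"
    using ab by (simp_all add: greenD_iff)
  have fc: "f a \<in> carrier B" "f b \<in> carrier B" using f(1) c by (auto simp: ncframe_hom_def)
  then have hc: "h (f a) \<in> carrier (H Y E)" "h (f b) \<in> carrier (H Y E)"
    using h by (auto simp: ncframe_hom_def)
  have hf: "h (f (x \<^bold>\<and> y)) = h (f x) \<^bold>\<and>\<^bsub>H Y E\<^esub> h (f y)" if "x \<in> carrier A" "y \<in> carrier A" for x y
  proof -
    have "f x \<in> carrier B" "f y \<in> carrier B" using f(1) that by (auto simp: ncframe_hom_def)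
    then show ?thesis using f(1) h that by (simp add: ncframe_hom_def)
  qed
  obtain U s where U: "h (f a) = (U, s)" by (cases "h (f a)")
  obtain V t where V: "h (f b) = (V, t)" by (cases "h (f b)")
  have "U \<inter> V = U" "V \<inter> U = V"
    using hf[OF c(1,2)] hf[OF c(2,1)] unfolding c(3,4) U V by (simp_all add: H_meet_eq)
  then have VU: "V = U" by blast
  have Us: "openin Y U" "s \<in> sections E U" "t \<in> sections E U"
    using hc unfolding U V VU by (simp_all add: carrier_H)
  have "h (f a) \<noteq> h (f b)"
    using kh fc f(2) c ab(2) by (metis inj_on_eq_iff)
  then have "s \<noteq> t" using U V VU by simp
  then obtain y where y: "y \<in> U" "\<not> same_germ y (U, s) (U, t)"
    using separated_by_germ[OF Us] by blast
  have refl: "same_germ y (U, s) (U, s)"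
    unfolding same_germ_def using y(1) front_open(1)[OF Us(1)] by auto
  \<comment> \<open>Compare germs at \<open>y\<close> with that of \<open>s\<close>, the section of \<open>h (f a)\<close>: \<open>a\<close> passes the test, \<open>b\<close> fails it.\<close>
  define e where "e = (\<lambda>x. if y \<in> fst x then Some (same_germ y (U, s) x) else None)"
  have "evaluation (H Y E) e" unfolding e_def by (rule evaluation_same_germ[OF Us(1,2)])
  then have "evaluation A ((e \<circ> h) \<circ> f)"
    by (intro evaluation_compose[OF f(1)] evaluation_compose[OF h])
  then show ?thesis
    by (rule hom_to_primitive_if_evaluation_differs[OF _ ab(1)])
      (simp add: U V VU e_def y refl)
qed

section \<open>Spatiality of the shadow and the natural map\<close>

lemma top_opens: "\<top>\<^bsub>frame_of_opens X\<^esub> = topspace X"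
  unfolding top_def
  by (rule some_equality) (auto simp: greatest_def frame_of_opens_def dest: openin_subset)

lemma meet_opens:
  assumes "openin X U" "openin X V"
  shows "U \<sqinter>\<^bsub>frame_of_opens X\<^esub> V = U \<inter> V"
proof -
  have g: "is_glb (frame_of_opens X) (U \<inter> V) {U, V}"
    using assms by (auto simp: greatest_def Lower_def frame_of_opens_def)
  show ?thesis
    unfolding meet_def inf_def
  proof (rule some_equality[where P = "\<lambda>x. is_glb (frame_of_opens X) x {U, V}", OF g])
    fix W assume "is_glb (frame_of_opens X) W {U, V}"
    then show "W = U \<inter> V" using g by (auto simp: greatest_def frame_of_opens_def)
  qed
qed

lemma sup_opens:
  assumes K: "K \<subseteq> {U. openin X U}"
  shows "\<Squnion>\<^bsub>frame_of_opens X\<^esub> K = \<Union>K"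
proof -
  have l: "is_lub (frame_of_opens X) (\<Union>K) K"
    using K by (auto simp: least_def Upper_def frame_of_opens_def subset_iff)
  show ?thesis
    unfolding sup_def
  proof (rule some_equality[where P = "\<lambda>x. is_lub (frame_of_opens X) x K", OF l])
    fix W assume "is_lub (frame_of_opens X) W K"
    then have "le (frame_of_opens X) W (\<Union>K)" "le (frame_of_opens X) (\<Union>K) W"
      using l unfolding least_def by blast+
    then show "W = \<Union>K" by (simp add: frame_of_opens_def)
  qed
qed

context left_handed_frame_over_frame
begin

text \<open>A point \<open>x\<close> of a space representing the shadow gives the frame homomorphism \<open>Z \<mapsto> x \<in> h Z\<close>, and
  opens are determined by their points.\<close>

lemma points_separate_Dclasses:
  assumes sp: "spatial_frame TYPE('x) (shadow A)"
    and ab: "a \<in> carrier A" "b \<in> carrier A" and eq: "basic_open A a = basic_open A b"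
  shows "Dclass A a = Dclass A b"
proof (rule ccontr)
  assume ne: "Dclass A a \<noteq> Dclass A b"
  obtain X :: "'x topology" where X: "frame_iso (shadow A) (frame_of_opens X)"
    using sp unfolding spatial_frame_def by (elim conjE exE)
  obtain h k where h: "frame_hom (shadow A) (frame_of_opens X) h"
      and kh: "\<forall>x\<in>carrier (shadow A). k (h x) = x"
    using X unfolding frame_iso_def by (elim conjE exE)
  have ho: "openin X (h Z)" if "Z \<in> carrier (shadow A)" for Z
    using h that by (auto simp: frame_hom_def frame_of_opens_def)
  have top: "h \<top>\<^bsub>shadow A\<^esub> = topspace X"
    using h by (simp add: frame_hom_def top_opens)
  have meet: "h (Z \<sqinter>\<^bsub>shadow A\<^esub> W) = h Z \<inter> h W"
    if "Z \<in> carrier (shadow A)" "W \<in> carrier (shadow A)" for Z W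
    using h that meet_opens[OF ho[OF that(1)] ho[OF that(2)]] by (simp add: frame_hom_def)
  have sup: "h (\<Squnion>\<^bsub>shadow A\<^esub> Q) = \<Union>(h ` Q)" if "Q \<subseteq> carrier (shadow A)" for Q
  proof -
    have "h ` Q \<subseteq> {U. openin X U}" using ho that by blast
    then show ?thesis using h that sup_opens by (simp add: frame_hom_def)
  qed
  have p: "(\<lambda>Z\<in>carrier (shadow A). x \<in> h Z) \<in> points A" if x: "x \<in> topspace X" for x
  proof -
    let ?p = "\<lambda>Z\<in>carrier (shadow A). x \<in> h Z"
    have "?p (\<Squnion>\<^bsub>shadow A\<^esub> Q) = \<Squnion>\<^bsub>two\<^esub> (?p ` Q)" if Q: "Q \<subseteq> carrier (shadow A)" for Q
    proof -
      have pQ: "?p Z \<longleftrightarrow> x \<in> h Z" if "Z \<in> Q" for Z using subsetD[OF Q that] by simp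
      have "?p (\<Squnion>\<^bsub>shadow A\<^esub> Q) \<longleftrightarrow> (\<exists>Z\<in>Q. x \<in> h Z)"
        using sup[OF Q] shadow.sup_closed[OF Q] by simp
      also have "\<dots> \<longleftrightarrow> (\<exists>Z\<in>Q. ?p Z)" by (intro bex_cong refl) (simp only: pQ)
      also have "\<dots> \<longleftrightarrow> \<Squnion>\<^bsub>two\<^esub> (?p ` Q)" by (simp only: sup_two bex_simps)
      finally show ?thesis .
    qed
    moreover have "?p (Z \<sqinter>\<^bsub>shadow A\<^esub> W) = ?p Z \<sqinter>\<^bsub>two\<^esub> ?p W"
      if "Z \<in> carrier (shadow A)" "W \<in> carrier (shadow A)" for Z W
      using that meet[OF that] shadow.meet_closed[OF that] by (simp add: meet_two)
    moreover have "?p \<top>\<^bsub>shadow A\<^esub> = \<top>\<^bsub>two\<^esub>" using x top top_two by simp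
    moreover have "?p \<in> carrier (shadow A) \<rightarrow> carrier two" by (simp add: two_def)
    ultimately show ?thesis unfolding points_def frame_hom_def by simp
  qed
  have D: "Dclass A a \<in> carrier (shadow A)" "Dclass A b \<in> carrier (shadow A)"
    using ab by (simp_all add: Dclass_in_shadow)
  have "x \<in> h (Dclass A a) \<longleftrightarrow> x \<in> h (Dclass A b)" if x: "x \<in> topspace X" for x
  proof -
    have "(\<lambda>Z\<in>carrier (shadow A). x \<in> h Z) \<in> basic_open A a \<longleftrightarrow> x \<in> h (Dclass A a)"
      "(\<lambda>Z\<in>carrier (shadow A). x \<in> h Z) \<in> basic_open A b \<longleftrightarrow> x \<in> h (Dclass A b)"
      using p[OF x] D by (simp_all add: basic_open_def)
    then show ?thesis using eq by simp
  qed
  then have "h (Dclass A a) = h (Dclass A b)"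
    using openin_subset[OF ho[OF D(1)]] openin_subset[OF ho[OF D(2)]] by blast
  then show False using kh D ne by metis
qed

text \<open>Suppose \<open>\<sigma> a = \<sigma> b\<close>. The domains agree, so \<open>a\<close> and \<open>b\<close> are equivalent and, if distinct, separated by a
  morphism \<open>q\<close>. The support of \<open>q\<close> is a point \<open>p\<close> at which \<open>a\<close> and \<open>b\<close> have the same germ. Applying \<open>q\<close> to
  the witnessing equation \<open>(a \<^bold>\<and> d) \<^bold>\<or> c = (b \<^bold>\<and> d) \<^bold>\<or> c\<close>, with \<open>q c\<close> zero and \<open>q d\<close> nonzero, yields
  \<open>q a = q b\<close>.\<close>

lemma inj_sigma_if_homs_separate:
  assumes sp: "spatial_frame TYPE('x) (shadow A)"
    and sep: "\<And>a b. \<lbrakk>(a, b) \<in> greenD A; a \<noteq> b\<rbrakk>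
      \<Longrightarrow> \<exists>q. ncframe_hom A primitive_skew q \<and> q a = OneA \<and> q b = OneB"
  shows "inj_on (sigma A) (carrier A)"
proof (rule inj_onI, rule ccontr)
  fix a b assume ab: "a \<in> carrier A" "b \<in> carrier A" "sigma A a = sigma A b" "a \<noteq> b"
  have U: "basic_open A a = basic_open A b" and s: "germ_section A a = germ_section A b"
    using ab(3) by (simp_all add: sigma_def)
  have "Dclass A a = Dclass A b" using points_separate_Dclasses[OF sp ab(1,2) U] .
  then have "(a, b) \<in> greenD A" using ab by (simp add: Dclass_eq_iff greenD_iff)
  then obtain q where q: "ncframe_hom A primitive_skew q" "q a = OneA" "q b = OneB"
    using sep ab(4) by blast
  define e where "e = prim_value \<circ> q"
  have e: "evaluation A e"
    unfolding e_def by (rule evaluation_compose[OF q(1) evaluation_prim_value])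
  have eab: "e a = Some True" "e b = Some False" using q by (simp_all add: e_def)
  obtain p where p: "p \<in> points A" and pe: "\<And>x. x \<in> carrier A \<Longrightarrow> p (Dclass A x) \<longleftrightarrow> e x \<noteq> None"
    using evaluation_support_is_point[OF e ab(1)] eab by auto
  have "p \<in> basic_open A a" "p \<in> basic_open A b"
    using p pe[OF ab(1)] pe[OF ab(2)] eab by (simp_all add: basic_open_def)
  then have "germ_rel A p `` {a} = germ_rel A p `` {b}"
    using fun_cong[OF s, of p] by (simp add: germ_section_def)
  then have "(a, b) \<in> germ_rel A p"
    using eq_equiv_class_iff[OF equiv_germ_rel[OF p], of a b] ab pe eab by simp
  then obtain c d where cd: "c \<in> carrier A" "d \<in> carrier A" "\<not> p (Dclass A c)" "p (Dclass A d)"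
    "(a \<^bold>\<and> d) \<^bold>\<or> c = (b \<^bold>\<and> d) \<^bold>\<or> c"
    unfolding germ_rel_def by blast
  have ecd: "e c = None" "e d \<noteq> None" using cd(3,4) pe[OF cd(1)] pe[OF cd(2)] by blast+
  have "e ((x \<^bold>\<and> d) \<^bold>\<or> c) = e x" if "x \<in> carrier A" for x
    using ecd by (simp add: evaluation_join[OF e meet_closed[OF that cd(2)] cd(1)]
      evaluation_meet[OF e that cd(2)] del: not_None_eq)
  then have "e a = e b" using cd(5) ab(1,2) by metis
  then show False using eab by simp
qed

lemma embeds_in_spatial_if_inj_sigma:
  assumes inj: "inj_on (sigma A) (carrier A)"
  shows "embeds_in_spatial
    TYPE('a point set \<times> 'a germ_section) TYPE('a point) TYPE('a germ_section) A"
proof -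
  let ?F = "function_sheaf :: ('a point, 'a germ_section) presheaf"
  let ?B = "H (Y_of A) ?F"
  interpret B: pointwise_algebra ?B "topspace (Y_of A)"
    "\<lambda>p x. if p \<in> fst x then Some (snd x p) else None"
    by (rule pointwise_function_sheaf)
  have open_iff: "openin (Y_of A) U \<longleftrightarrow> (\<exists>a\<in>carrier A. U = basic_open A a)" for U
    by (rule openin_Y_of) (rule shadow.frame_axioms)
  have pts: "p \<in> points A" if "p \<in> topspace (Y_of A)" for p
    using that unfolding topspace_def open_iff by (auto simp: basic_open_def)
  have iso: "ncframe_iso ?B ?B"
  proof -
    have "ncframe_hom ?B ?B (\<lambda>x. x)" by (simp add: ncframe_hom_def)
    then show ?thesis unfolding ncframe_iso_def by blast
  qed
  have "restrict undefined (topspace (Y_of A)) \<in> sections ?F (topspace (Y_of A))" by simp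
  then have nonempty: "sections ?F (topspace (Y_of A)) \<noteq> {}" by blast
  have spatial: "spatial_ncframe TYPE('a point) TYPE('a germ_section) ?B"
    unfolding spatial_ncframe_def
    by (intro conjI exI[of _ "Y_of A"] exI[of _ ?F] B.noncommutative_frame B.left_handed
        sheaf_function_sheaf nonempty iso)
  have "ncframe_hom A ?B (sigma A)"
  proof (rule B.ncframe_homI)
    show "skew_lattice_with_zero A" by (rule skew_lattice_with_zero_axioms)
    show "sigma A x \<in> carrier ?B" if "x \<in> carrier A" for x
      using that open_iff by (auto simp: sigma_def H_def germ_section_def)
    show "evaluation A (\<lambda>x. if p \<in> fst (sigma A x) then Some (snd (sigma A x) p) else None)"
      if "p \<in> topspace (Y_of A)" for p
      unfolding sigma_def fst_conv snd_conv by (rule evaluation_germ_section[OF pts[OF that]])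
    show "(if p \<in> fst (sigma A m) then Some (snd (sigma A m) p) else None) \<noteq> None"
      if "m \<in> maximal_Dclass A" "p \<in> topspace (Y_of A)" for m p
      using point_maximal[OF pts[OF that(2)] that(1)] pts[OF that(2)]
      by (simp add: sigma_def basic_open_def)
  qed
  then show ?thesis
    unfolding embeds_in_spatial_def by (intro exI[of _ ?B] exI[of _ "sigma A"] conjI spatial inj)
qed

lemma embeds_in_partial_functions_if_inj_sigma:
  assumes inj: "inj_on (sigma A) (carrier A)"
  shows "embeds_in_partial_functions TYPE('a point) TYPE('a germ) A"
proof -
  let ?P = "partial_functions (points A) (UNIV :: 'a germ set)"
  define f where
    "f a = (\<lambda>p. if p \<in> basic_open A a then Some (germ_section A a p) else None)" for a
  interpret P: pointwise_algebra ?P "points A" "\<lambda>p g. g p"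
    by (rule pointwise_partial_functions)
  have "ncframe_hom A ?P f"
  proof (rule P.ncframe_homI)
    show "skew_lattice_with_zero A" by (rule skew_lattice_with_zero_axioms)
    show "f x \<in> carrier ?P" for x
      by (auto simp: partial_functions_def f_def basic_open_def split: if_splits)
    show "evaluation A (\<lambda>x. f x p)" if "p \<in> points A" for p
      unfolding f_def by (rule evaluation_germ_section[OF that])
    show "f m p \<noteq> None" if "m \<in> maximal_Dclass A" "p \<in> points A" for m p
      using point_maximal[OF that(2,1)] that(2) by (simp add: f_def basic_open_def)
  qed
  moreover have "inj_on f (carrier A)"
  proof (rule inj_onI)
    fix a b assume ab: "a \<in> carrier A" "b \<in> carrier A" "f a = f b"
    have U: "basic_open A a = basic_open A b"
    proof (rule Set.set_eqI)
      fix p show "p \<in> basic_open A a \<longleftrightarrow> p \<in> basic_open A b"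
        using fun_cong[OF ab(3), of p] by (simp add: f_def split: if_splits)
    qed
    have "germ_section A a = germ_section A b"
    proof
      fix p show "germ_section A a p = germ_section A b p"
      proof (cases "p \<in> basic_open A a")
        case True
        then show ?thesis using fun_cong[OF ab(3), of p] U by (simp add: f_def)
      next
        case False
        then show ?thesis using U by (simp add: germ_section_def)
      qed
    qed
    then show "a = b" using inj_onD[OF inj] U ab(1,2) by (simp add: sigma_def)
  qed
  ultimately show ?thesis
    unfolding embeds_in_partial_functions_def
    by (intro exI[of _ "points A"] exI[of _ UNIV] exI[of _ f] conjI)
qed

end

theorem proposition4p1:
  fixes A :: "'a skew_algebra"
  assumes "noncommutative_frame A" and "left_handed A"
    and "spatial_frame TYPE('x) (shadow A)"
  defines "c1 \<equiv> \<forall>a b. (a, b) \<in> greenD A \<and> a \<noteq> b \<longrightarrow>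
      (\<exists>q. ncframe_hom A primitive_skew q \<and> q a = OneA \<and> q b = OneB)"
    and "c2 \<equiv> inj_on (sigma A) (carrier A)"
    and "c3 \<equiv> embeds_in_spatial
      TYPE('a point set \<times> 'a germ_section) TYPE('a point) TYPE('a germ_section) A"
    and "c4 \<equiv> embeds_in_partial_functions TYPE('a point) TYPE('a germ) A"
  shows "(c1 \<longleftrightarrow> c2) \<and> (c1 \<longleftrightarrow> c3) \<and> (c1 \<longleftrightarrow> c4) \<and>
    (embeds_in_spatial TYPE('b) TYPE('y) TYPE('s) A \<longrightarrow> c3) \<and>
    (embeds_in_partial_functions TYPE('r) TYPE('t) A \<longrightarrow> c4)"
proof -
  interpret N: noncommutative_frame A by fact
  interpret left_handed_frame A
    by (intro left_handed_frame.intro left_handed_skew_lattice.intro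
        left_handed_skew_lattice_axioms.intro N.skew_lattice_axioms assms)
  interpret left_handed_frame_over_frame A
    using assms(3) by (intro left_handed_frame_over_frame.intro left_handed_frame_axioms)
      (simp add: spatial_frame_def)
  have 12: "c1 \<Longrightarrow> c2"
    unfolding c1_def c2_def by (rule inj_sigma_if_homs_separate[OF assms(3)]) simp
  have 23: "c2 \<Longrightarrow> c3" unfolding c2_def c3_def by (rule embeds_in_spatial_if_inj_sigma)
  have 24: "c2 \<Longrightarrow> c4" unfolding c2_def c4_def by (rule embeds_in_partial_functions_if_inj_sigma)
  have 31: c1 if "c3"
    unfolding c1_def
    by (intro allI impI, elim conjE, rule hom_to_primitive_if_embeds_in_spatial[OF that[unfolded c3_def]])
  have 41: c1 if "c4"
    unfolding c1_def
    by (intro allI impI, elim conjE, rule hom_to_primitive_if_embeds_in_partial_functions[OF that[unfolded c4_def]])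
  have s1: c1 if "embeds_in_spatial TYPE('b) TYPE('y) TYPE('s) A"
    unfolding c1_def
    by (intro allI impI, elim conjE, rule hom_to_primitive_if_embeds_in_spatial[OF that])
  have p1: c1 if "embeds_in_partial_functions TYPE('r) TYPE('t) A"
    unfolding c1_def
    by (intro allI impI, elim conjE, rule hom_to_primitive_if_embeds_in_partial_functions[OF that])
  show ?thesis using 12 23 24 31 41 s1 p1 by blast
qed

end
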